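(* Let $(\Omega,\Sigma,\mu)$ be a measure space with $\mu$ not purely atomic and let $Y$ be a Banach space over $\mathbb K\in\{\mathbb R,\mathbb C\}$ with $\dim(Y)\geq2$. Let $$D=\Big\{u=\sum_{i=1}^\infty f_i\otimes y_i\in L_1(\mu)\widehat{\otimes}_\pi Y:\ \mu(\operatorname{supp} f_i\cap\operatorname{supp} f_j)=0\ \ \forall i\neq j\Big\}.$$ Then $\mathrm{NA}_\pi(L_1(\mu)\widehat{\otimes}_\pi Y)=D$ if and only if $Y$ is strictly convex. If $Y$ is not strictly convex, then $D\subsetneq\mathrm{NA}_\pi(L_1(\mu)\widehat{\otimes}_\pi Y)$.
   Context: $X\widehat{\otimes}_\pi Y$ denotes the projective tensor product. An element $u\in X\widehat{\otimes}_\pi Y$ attains its projective norm if there are $(x_i)\subseteq X$, $(y_i)\subseteq Y$ with $u=\sum_{i=1}^\infty x_i\otimes y_i$ and $\|u\|_\pi=\sum_{i=1}^\infty\|x_i\|\|y_i\|$; $\mathrm{NA}_\pi(X\widehat{\otimes}_\pi Y)$ is the set of such elements. $L_1(\mu)\widehat{\otimes}_\pi Y$ is isometrically identified with the space $L_1(\mu,Y)$ of Bochner integrable functions via $(f\otimes y)(\omega)=f(\omega)y$; in the definition of $D$, $f_i\in L_1(\mu)$, $y_i\in Y$ and sums converge in norm. $\operatorname{supp} f=\{\omega:f(\omega)\neq0\}$. $Y$ is strictly convex if $\|x+y\|<2$ for all distinct unit vectors $x,y\in Y$. A set $A\in\Sigma$ is an atom if $0<\mu(A)<\infty$ and every measurable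 $B\subseteq A$ has $\mu(B)=0$ or $\mu(B)=\mu(A)$. A set $E\in\Sigma$ with $0<\mu(E)<\infty$ is purely atomic if it coincides, modulo a null set, with the union of the (countably many, modulo null sets) atoms contained in $E$; $\mu$ is purely atomic if every $E\in\Sigma$ with $0<\mu(E)<\infty$ is purely atomic. *)

theory Defs
  imports "HOL-Analysis.Analysis" "HOL-Library.Function_Algebras"
begin

section \<open>The scalar field\<close>

text \<open>The field \<open>K\<close> is the real or the complex field. The remaining superclasses, which follow from
  the class assumption, are those required by the Bochner integral of the library.\<close>

class real_or_complex = real_normed_field + banach + second_countable_topology +
  assumes real_or_complex:
    "(\<exists>\<phi> :: 'a \<Rightarrow> real. bij \<phi> \<and> (\<forall>x y. \<phi> (x + y) = \<phi> x + \<phi> y) \<and>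
        (\<forall>x y. \<phi> (x * y) = \<phi> x * \<phi> y) \<and> (\<forall>x. norm (\<phi> x) = norm x)) \<or>
     (\<exists>\<phi> :: 'a \<Rightarrow> complex. bij \<phi> \<and> (\<forall>x y. \<phi> (x + y) = \<phi> x + \<phi> y) \<and>
        (\<forall>x y. \<phi> (x * y) = \<phi> x * \<phi> y) \<and> (\<forall>x. norm (\<phi> x) = norm x))"

instance real :: real_or_complex
  by standard (rule disjI1, rule exI[of _ "\<lambda>x. x"], simp add: bij_def)

instance complex :: real_or_complex
  by standard (rule disjI2, rule exI[of _ "\<lambda>x. x"], simp add: bij_def)


section \<open>Normed spaces over the scalar field\<close>

text \<open>A space is given by its carrier inside an additive group, its scalar multiplication and its
  norm. The norm may be a seminorm; the normed space meant is then the quotient by the elements of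
  norm zero. In this way \<open>L\<^sub>1(\<mu>)\<close> is represented by functions rather than by their classes modulo
  almost everywhere equality.\<close>

record ('k, 'x) space =
  car :: "'x set"
  scal :: "'k \<Rightarrow> 'x \<Rightarrow> 'x"
  nrm :: "'x \<Rightarrow> real"

definition banach_scale :: "('k::real_or_complex \<Rightarrow> 'y::banach \<Rightarrow> 'y) \<Rightarrow> bool" where
  "banach_scale sm \<longleftrightarrow> vector_space sm \<and>
     (\<forall>r y. sm (of_real r) y = r *\<^sub>R y) \<and> (\<forall>c y. norm (sm c y) = norm c * norm y)"

definition whole_space :: "('k \<Rightarrow> 'y::real_normed_vector \<Rightarrow> 'y) \<Rightarrow> ('k, 'y) space" where
  "whole_space sm = \<lparr>car = UNIV, scal = sm, nrm = norm\<rparr>"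

definition L1 :: "'a measure \<Rightarrow> ('k::real_or_complex, 'a \<Rightarrow> 'k) space" where
  "L1 M = \<lparr>car = {f. integrable M f}, scal = (\<lambda>c f \<omega>. c * f \<omega>),
           nrm = (\<lambda>f. \<integral>\<omega>. norm (f \<omega>) \<partial>M)\<rparr>"

definition strictly_convex :: "('k, 'y::ab_group_add) space \<Rightarrow> bool" where
  "strictly_convex Y \<longleftrightarrow> (\<forall>x\<in>car Y. \<forall>y\<in>car Y.
     nrm Y x = 1 \<and> nrm Y y = 1 \<and> x \<noteq> y \<longrightarrow> nrm Y (x + y) < 2)"


section \<open>The projective tensor product\<close>

text \<open>Bilinear forms on the quotients of \<open>X\<close> and \<open>Y\<close> by the elements of norm zero; no continuity is
  required.\<close>

definition bilinear_form ::
    "('k::real_or_complex, 'x::ab_group_add) space \<Rightarrow> ('k, 'y::ab_group_add) space \<Rightarrow>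
     ('x \<Rightarrow> 'y \<Rightarrow> 'k) \<Rightarrow> bool" where
  "bilinear_form X Y B \<longleftrightarrow>
     (\<forall>x\<in>car X. \<forall>x'\<in>car X. \<forall>y\<in>car Y. B (x + x') y = B x y + B x' y) \<and>
     (\<forall>x\<in>car X. \<forall>y\<in>car Y. \<forall>y'\<in>car Y. B x (y + y') = B x y + B x y') \<and>
     (\<forall>c. \<forall>x\<in>car X. \<forall>y\<in>car Y. B (scal X c x) y = c * B x y) \<and>
     (\<forall>c. \<forall>x\<in>car X. \<forall>y\<in>car Y. B x (scal Y c y) = c * B x y) \<and>
     (\<forall>x\<in>car X. \<forall>y\<in>car Y. nrm X x = 0 \<or> nrm Y y = 0 \<longrightarrow> B x y = 0)"

text \<open>The algebraic tensor product is realised as the space of functionals on bilinear forms spanned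
  by the evaluations \<open>B \<mapsto> B x y\<close>. Functionals are extended by zero to arguments that are not
  bilinear forms; sums and differences of them are pointwise.\<close>

definition tensor ::
    "('k::real_or_complex, 'x::ab_group_add) space \<Rightarrow> ('k, 'y::ab_group_add) space \<Rightarrow>
     'x \<Rightarrow> 'y \<Rightarrow> ('x \<Rightarrow> 'y \<Rightarrow> 'k) \<Rightarrow> 'k" where
  "tensor X Y x y = (\<lambda>B. if bilinear_form X Y B then B x y else 0)"

definition alg_tensor ::
    "('k::real_or_complex, 'x::ab_group_add) space \<Rightarrow> ('k, 'y::ab_group_add) space \<Rightarrow>
     (('x \<Rightarrow> 'y \<Rightarrow> 'k) \<Rightarrow> 'k) set" where
  "alg_tensor X Y = {\<Sum>i<n. tensor X Y (x i) (y i) | (n::nat) x y.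
     (\<forall>i. x i \<in> car X) \<and> (\<forall>i. y i \<in> car Y)}"

definition alg_proj_norm ::
    "('k::real_or_complex, 'x::ab_group_add) space \<Rightarrow> ('k, 'y::ab_group_add) space \<Rightarrow>
     (('x \<Rightarrow> 'y \<Rightarrow> 'k) \<Rightarrow> 'k) \<Rightarrow> real" where
  "alg_proj_norm X Y t = Inf {\<Sum>i<n. nrm X (x i) * nrm Y (y i) | (n::nat) x y.
     (\<forall>i. x i \<in> car X) \<and> (\<forall>i. y i \<in> car Y) \<and> t = (\<Sum>i<n. tensor X Y (x i) (y i))}"

text \<open>The completion: classes of Cauchy sequences modulo sequences tending to zero.\<close>

definition tensor_Cauchy ::
    "('k::real_or_complex, 'x::ab_group_add) space \<Rightarrow> ('k, 'y::ab_group_add) space \<Rightarrow>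
     (nat \<Rightarrow> ('x \<Rightarrow> 'y \<Rightarrow> 'k) \<Rightarrow> 'k) set" where
  "tensor_Cauchy X Y = {U. (\<forall>n. U n \<in> alg_tensor X Y) \<and>
     (\<forall>e>0. \<exists>N. \<forall>m\<ge>N. \<forall>n\<ge>N. alg_proj_norm X Y (U m - U n) < e)}"

definition tensor_equiv ::
    "('k::real_or_complex, 'x::ab_group_add) space \<Rightarrow> ('k, 'y::ab_group_add) space \<Rightarrow>
     ((nat \<Rightarrow> ('x \<Rightarrow> 'y \<Rightarrow> 'k) \<Rightarrow> 'k) \<times> (nat \<Rightarrow> ('x \<Rightarrow> 'y \<Rightarrow> 'k) \<Rightarrow> 'k)) set" where
  "tensor_equiv X Y = {(U, V). U \<in> tensor_Cauchy X Y \<and> V \<in> tensor_Cauchy X Y \<and>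
     (\<lambda>n. alg_proj_norm X Y (U n - V n)) \<longlonglongrightarrow> 0}"

definition proj_tensor ::
    "('k::real_or_complex, 'x::ab_group_add) space \<Rightarrow> ('k, 'y::ab_group_add) space \<Rightarrow>
     (nat \<Rightarrow> ('x \<Rightarrow> 'y \<Rightarrow> 'k) \<Rightarrow> 'k) set set" where
  "proj_tensor X Y = tensor_Cauchy X Y // tensor_equiv X Y"

definition proj_norm ::
    "('k::real_or_complex, 'x::ab_group_add) space \<Rightarrow> ('k, 'y::ab_group_add) space \<Rightarrow>
     (nat \<Rightarrow> ('x \<Rightarrow> 'y \<Rightarrow> 'k) \<Rightarrow> 'k) set \<Rightarrow> real" where
  "proj_norm X Y u = (THE r. \<forall>U\<in>u. (\<lambda>n. alg_proj_norm X Y (U n)) \<longlonglongrightarrow> r)"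

text \<open>A series of elementary tensors converges in norm to the element \<open>u\<close> of the completion iff its
  sequence of partial sums is a Cauchy sequence representing \<open>u\<close>.\<close>

definition tensor_sums ::
    "('k::real_or_complex, 'x::ab_group_add) space \<Rightarrow> ('k, 'y::ab_group_add) space \<Rightarrow>
     (nat \<Rightarrow> 'x) \<Rightarrow> (nat \<Rightarrow> 'y) \<Rightarrow> (nat \<Rightarrow> ('x \<Rightarrow> 'y \<Rightarrow> 'k) \<Rightarrow> 'k) set \<Rightarrow> bool" where
  "tensor_sums X Y x y u \<longleftrightarrow> (\<forall>i. x i \<in> car X) \<and> (\<forall>i. y i \<in> car Y) \<and>
     (\<lambda>n. \<Sum>i<n. tensor X Y (x i) (y i)) \<in> u"

definition NA_proj ::
    "('k::real_or_complex, 'x::ab_group_add) space \<Rightarrow> ('k, 'y::ab_group_add) space \<Rightarrow>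
     (nat \<Rightarrow> ('x \<Rightarrow> 'y \<Rightarrow> 'k) \<Rightarrow> 'k) set set" where
  "NA_proj X Y = {u \<in> proj_tensor X Y. \<exists>x y. tensor_sums X Y x y u \<and>
     (\<lambda>i. nrm X (x i) * nrm Y (y i)) sums proj_norm X Y u}"


section \<open>Disjointly supported tensors and atoms\<close>

definition supp :: "'a measure \<Rightarrow> ('a \<Rightarrow> 'k::zero) \<Rightarrow> 'a set" where
  "supp M f = {\<omega> \<in> space M. f \<omega> \<noteq> 0}"

definition disjoint_tensors ::
    "'a measure \<Rightarrow> ('k::real_or_complex, 'y::ab_group_add) space \<Rightarrow>
     (nat \<Rightarrow> (('a \<Rightarrow> 'k) \<Rightarrow> 'y \<Rightarrow> 'k) \<Rightarrow> 'k) set set" where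
  "disjoint_tensors M Y = {u \<in> proj_tensor (L1 M) Y. \<exists>f y. tensor_sums (L1 M) Y f y u \<and>
     (\<forall>i j. i \<noteq> j \<longrightarrow> emeasure M (supp M (f i) \<inter> supp M (f j)) = 0)}"

definition atom :: "'a measure \<Rightarrow> 'a set \<Rightarrow> bool" where
  "atom M A \<longleftrightarrow> A \<in> sets M \<and> 0 < emeasure M A \<and> emeasure M A < \<infinity> \<and>
     (\<forall>B\<in>sets M. B \<subseteq> A \<longrightarrow> emeasure M B = 0 \<or> emeasure M B = emeasure M A)"

text \<open>The family \<open>\<A>\<close> picks representatives of the atoms contained in \<open>E\<close> modulo null sets. If it
  covers \<open>E\<close> up to a null set, every atom contained in \<open>E\<close> agrees with a member of \<open>\<A>\<close> up to a null
  set.\<close>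

definition purely_atomic_set :: "'a measure \<Rightarrow> 'a set \<Rightarrow> bool" where
  "purely_atomic_set M E \<longleftrightarrow>
     (\<exists>\<A>. countable \<A> \<and> (\<forall>A\<in>\<A>. atom M A \<and> A \<subseteq> E) \<and> E - \<Union>\<A> \<in> null_sets M)"

definition purely_atomic :: "'a measure \<Rightarrow> bool" where
  "purely_atomic M \<longleftrightarrow>
     (\<forall>E\<in>sets M. 0 < emeasure M E \<and> emeasure M E < \<infinity> \<longrightarrow> purely_atomic_set M E)"

end

theory Submission
  imports Defs
begin

text \<open>An algebraic tensor \<open>\<Sum>i<n. f i \<otimes> y i\<close> has projective norm
  \<open>\<integral>\<parallel>\<Sum>i<n. f i \<omega> y i\<parallel> d\<mu>\<close>. A series with disjointly supported coefficients is therefore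
  automatically optimal. Conversely, optimality of a series forces
  \<open>\<parallel>\<Sum>i<n. f i \<omega> y i\<parallel> = \<Sum>i<n. \<parallel>f i \<omega> y i\<parallel>\<close> almost everywhere for all \<open>n\<close>. If \<open>Y\<close> is strictly convex,
  vectors \<open>y i\<close> whose coefficients do not vanish at a common point are then proportional, and
  collecting proportional vectors makes the supports disjoint.

  If the unit sphere of \<open>Y\<close> contains a segment from \<open>a\<close> to \<open>b\<close>, take a function \<open>\<tau>\<close> with values in
  \<open>[0, 1]\<close> on an atomless set \<open>F\<close>, all of whose level sets are null. Then
  \<open>\<tau> \<otimes> a + (1\<^sub>F - \<tau>) \<otimes> b\<close> attains its norm. A disjointly supported representation would place almost
  all its values on countably many lines, each of which meets the segment in at most one point, so
  that \<open>F\<close> would be covered by countably many level sets of \<open>\<tau>\<close>.\<close>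

section \<open>Diffuse functions on atomless sets\<close>

text \<open>Exhaustion: pooling countable families of atoms in \<open>E\<close> whose unions come
  ever closer to the supremal measure yields a family that attains it. An atom in the remainder
  \<open>F\<close> could be added and would exceed the supremum, and \<open>F\<close> is not null
  because \<open>E\<close> is not purely atomic.\<close>

lemma not_purely_atomicE:
  assumes "\<not> purely_atomic M"
  obtains F where "F \<in> fmeasurable M" "0 < emeasure M F"
    "\<And>A. A \<subseteq> F \<Longrightarrow> \<not> atom M A"
proof -
  obtain E where E: "E \<in> sets M" "emeasure M E < \<infinity>" and npa: "\<not> purely_atomic_set M E"
    using assms unfolding purely_atomic_def by blast
  then have Ef: "E \<in> fmeasurable M" by (auto intro: fmeasurableI)
  define \<C> where "\<C> = {\<A>. countable \<A> \<and> (\<forall>A\<in>\<A>. atom M A \<and> A \<subseteq> E)}"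
  have \<C>_sets: "\<Union>\<A> \<in> sets M" "\<Union>\<A> \<subseteq> E" if "\<A> \<in> \<C>" for \<A>
    using that by (auto simp: \<C>_def atom_def intro!: sets.countable_Union)
  have \<C>_fm: "\<Union>\<A> \<in> fmeasurable M" if "\<A> \<in> \<C>" for \<A>
    using \<C>_sets[OF that] Ef by (meson fmeasurableI2)
  define s where "s = (SUP \<A>\<in>\<C>. measure M (\<Union>\<A>))"
  have bdd: "bdd_above ((\<lambda>\<A>. measure M (\<Union>\<A>)) ` \<C>)"
    using \<C>_sets Ef by (auto intro!: bdd_aboveI2[where M = "measure M E"] measure_mono_fmeasurable)
  have ne: "\<C> \<noteq> {}"
    by (auto simp: \<C>_def intro: exI[of _ "{}"])
  have "\<exists>\<A>\<in>\<C>. s - 1 / Suc n < measure M (\<Union>\<A>)" for n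
    using less_cSUP_iff[OF ne bdd, of "s - 1 / Suc n"] by (simp add: s_def)
  then obtain \<A> where \<A>: "\<And>n. \<A> n \<in> \<C>" "\<And>n. s - 1 / Suc n < measure M (\<Union>(\<A> n))"
    by metis
  define \<A>' where "\<A>' = (\<Union>n. \<A> n)"
  have \<A>': "\<A>' \<in> \<C>"
    using \<A>(1) unfolding \<A>'_def \<C>_def by fastforce
  have "s - 1 / Suc n \<le> measure M (\<Union>\<A>')" for n
  proof -
    have "measure M (\<Union>(\<A> n)) \<le> measure M (\<Union>\<A>')"
      by (rule measure_mono_fmeasurable) (use \<A>(1) \<A>' \<C>_sets \<C>_fm in \<open>auto simp: \<A>'_def\<close>)
    with \<A>(2)[of n] show ?thesis by linarith
  qed
  moreover have "(\<lambda>n. s - 1 / real (Suc n)) \<longlonglongrightarrow> s - 0"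
    by (intro tendsto_diff tendsto_const LIMSEQ_Suc[OF lim_1_over_n])
  ultimately have s_le: "s \<le> measure M (\<Union>\<A>')"
    by (intro LIMSEQ_le_const2) auto
  define F where "F = E - \<Union>\<A>'"
  have F: "F \<in> fmeasurable M"
    using Ef \<C>_sets[OF \<A>'] by (auto simp: F_def intro: fmeasurable_Diff)
  have "F \<notin> null_sets M"
    using npa \<A>' unfolding purely_atomic_set_def \<C>_def F_def by blast
  with F have "0 < emeasure M F"
    by (auto simp: null_sets_def zero_less_iff_neq_zero)
  moreover have "\<not> atom M A" if "A \<subseteq> F" for A
  proof
    assume at: "atom M A"
    then have "insert A \<A>' \<in> \<C>"
      using that \<A>' by (auto simp: \<C>_def F_def)
    then have "measure M (\<Union>(insert A \<A>')) \<le> s"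
      unfolding s_def using bdd by (rule cSUP_upper)
    also have "measure M (\<Union>(insert A \<A>')) = measure M A + measure M (\<Union>\<A>')"
      unfolding Union_insert
      by (rule measure_Union) (use at that \<C>_sets[OF \<A>'] \<C>_fm[OF \<A>'] in
          \<open>auto simp: atom_def F_def fmeasurable_def less_top\<close>)
    also have "0 < measure M A"
      using at by (auto simp: atom_def measure_def enn2real_positive_iff less_top)
    ultimately show False using s_le by linarith
  qed
  ultimately show thesis using F by (intro that)
qed

text \<open>A set of positive finite measure that is not an atom splits into two parts of positive
  measure, and the smaller one has at most half the measure.\<close>

lemma atomless_small_subset:
  assumes F: "F \<in> fmeasurable M" and atomless: "\<And>A. A \<subseteq> F \<Longrightarrow> \<not> atom M A"
    and A: "A \<in> sets M" "A \<subseteq> F" "0 < measure M A"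
  obtains B where "B \<in> sets M" "B \<subseteq> A" "0 < measure M B" "measure M B \<le> measure M A / 2"
proof -
  have fin: "B \<in> fmeasurable M" if "B \<in> sets M" "B \<subseteq> A" for B
    using that A F by (meson fmeasurableI2 order_trans)
  have em: "emeasure M B = ennreal (measure M B)" if "B \<in> sets M" "B \<subseteq> A" for B
    using fin[OF that] by (rule emeasure_eq_measure2)
  have "emeasure M A < \<infinity>" "0 < emeasure M A"
    using A(3) em[OF A(1) order_refl] by simp_all
  moreover have "\<not> atom M A" using atomless A(2) by blast
  ultimately obtain B where B: "B \<in> sets M" "B \<subseteq> A" "emeasure M B \<noteq> 0" "emeasure M B \<noteq> emeasure M A"
    using A(1) unfolding atom_def by blast
  have "measure M B \<noteq> 0" "measure M B \<noteq> measure M A"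
    using B(3,4) em[OF A(1) order_refl] em[OF B(1,2)] by auto
  moreover have "measure M (A - B) = measure M A - measure M B"
    by (rule measurable_measure_Diff) (use fin[OF A(1) order_refl] B in auto)
  moreover have "measure M (A - B) \<ge> 0" "measure M B \<ge> 0" by auto
  ultimately have "0 < measure M B" "0 < measure M (A - B)"
    "measure M B \<le> measure M A / 2 \<or> measure M (A - B) \<le> measure M A / 2"
    by linarith+
  moreover have "A - B \<in> sets M" using A(1) B(1) by (rule sets.Diff)
  ultimately show thesis
    using that[OF B(1,2)] that[of "A - B"] by blast
qed

text \<open>Base three keeps the coding of bit sequences injective.\<close>

definition ternary :: "(nat \<Rightarrow> bool) \<Rightarrow> real" where
  "ternary b = (\<Sum>n. of_bool (b n) / 3 ^ Suc n)"

lemma ternary_summable: "summable (\<lambda>n. of_bool (b n) / 3 ^ Suc n :: real)"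
proof (rule summable_comparison_test)
  show "summable (\<lambda>n. (1 / 3) * (1 / 3) ^ n :: real)"
    by (intro summable_mult summable_geometric) simp
qed (auto simp: power_one_over)

lemma ternary_bounds: "0 \<le> ternary b" "ternary b \<le> 1 / 2"
proof -
  show "0 \<le> ternary b"
    unfolding ternary_def by (intro suminf_nonneg ternary_summable) auto
  have "(\<lambda>n. (1 / 3) * (1 / 3) ^ n :: real) sums (1 / 3 * (1 / (1 - 1 / 3)))"
    by (intro sums_mult geometric_sums) simp
  then have s: "(\<lambda>n. 1 / 3 ^ Suc n :: real) sums (1 / 2)"
    by (simp add: power_one_over)
  have "ternary b \<le> (\<Sum>n. 1 / 3 ^ Suc n)"
    unfolding ternary_def
    by (intro suminf_le ternary_summable sums_summable[OF s]) auto
  with s show "ternary b \<le> 1 / 2" by (simp add: sums_iff)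
qed

lemma ternary_shift: "ternary b = (of_bool (b 0) + ternary (\<lambda>n. b (Suc n))) / 3"
proof -
  have "ternary b = of_bool (b 0) / 3 + (\<Sum>n. of_bool (b (Suc n)) / 3 ^ Suc (Suc n))"
    using suminf_split_head[OF ternary_summable[of b]] by (simp add: ternary_def)
  also have "(\<Sum>n. of_bool (b (Suc n)) / 3 ^ Suc (Suc n)) =
      (\<Sum>n. (of_bool (b (Suc n)) / 3 ^ Suc n) / 3 :: real)"
    by (simp add: mult.commute)
  also have "\<dots> = ternary (\<lambda>n. b (Suc n)) / 3"
    unfolding ternary_def using suminf_divide[OF ternary_summable[of "\<lambda>n. b (Suc n)"], of 3] by simp
  finally show ?thesis by (simp add: add_divide_distrib)
qed

text \<open>Tails lie in \<open>[0, 1 / 2]\<close>, so the value is at most \<open>1 / 6\<close> if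
  the first bit is false and at least \<open>1 / 3\<close> if it is true. The value thus determines
  the first bit and then, by shifting, all others.\<close>

lemma ternary_inject: "ternary b = ternary b' \<Longrightarrow> b n = b' n"
proof (induction n arbitrary: b b')
  case (0 b b')
  then show ?case
    using ternary_shift[of b] ternary_shift[of b'] ternary_bounds[of "\<lambda>n. b (Suc n)"]
      ternary_bounds[of "\<lambda>n. b' (Suc n)"]
    by (cases "b 0"; cases "b' 0") auto
next
  case (Suc n b b')
  have head: "b 0 = b' 0"
    using Suc.prems ternary_shift[of b] ternary_shift[of b'] ternary_bounds[of "\<lambda>n. b (Suc n)"]
      ternary_bounds[of "\<lambda>n. b' (Suc n)"]
    by (cases "b 0"; cases "b' 0") auto
  then have "ternary (\<lambda>n. b (Suc n)) = ternary (\<lambda>n. b' (Suc n))"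
    using Suc.prems ternary_shift[of b] ternary_shift[of b'] by simp
  from Suc.IH[OF this] show ?case .
qed

text \<open>A binary tree of sets with root \<open>F\<close>: \<open>B\<close> chooses the part
  split off from a cell, and a point follows the part or the remainder according to membership in
  the part. Points outside \<open>F\<close> are assigned a branch of the same tree.\<close>

primrec cell :: "('a set \<Rightarrow> 'a set) \<Rightarrow> 'a set \<Rightarrow> 'a \<Rightarrow> nat \<Rightarrow> 'a set" where
  "cell B F \<omega> 0 = F"
| "cell B F \<omega> (Suc n) =
     (if \<omega> \<in> B (cell B F \<omega> n) then B (cell B F \<omega> n) else cell B F \<omega> n - B (cell B F \<omega> n))"

lemma cell_mem: "\<omega> \<in> F \<Longrightarrow> \<omega> \<in> cell B F \<omega> n"
  by (induction n) auto

text \<open>As \<open>B C \<subseteq> C\<close>, a point of a cell also lies in all its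
  predecessors, and so it takes the same turn at every earlier depth.\<close>

lemma cell_eq:
  assumes "\<And>C. C \<in> \<S> \<Longrightarrow> B C \<subseteq> C" "\<And>n. cell B F \<omega>' n \<in> \<S>"
  shows "\<omega> \<in> cell B F \<omega>' n \<Longrightarrow> cell B F \<omega> n = cell B F \<omega>' n"
proof (induction n)
  case (Suc n)
  then have "\<omega> \<in> cell B F \<omega>' n"
    using assms by (auto split: if_splits)
  with Suc show ?case by (auto split: if_splits)
qed simp

text \<open>Splitting off from every cell a subset of at most half its measure, nearly as large as
  possible, drives the measure of the cells along every branch to zero: otherwise the intersection
  of a branch would contain a small set \<open>C\<close> of positive measure, and each cell of the branch would
  lose at least half the measure of \<open>C\<close>.\<close>

lemma atomless_diffuse_function:
  fixes F :: "'a set"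
  assumes F: "F \<in> fmeasurable M" and atomless: "\<And>A. A \<subseteq> F \<Longrightarrow> \<not> atom M A"
  obtains f :: "'a \<Rightarrow> real" where "f \<in> borel_measurable M" "\<And>\<omega>. 0 \<le> f \<omega>" "\<And>\<omega>. f \<omega> \<le> 1"
    "\<And>t. {\<omega> \<in> F. f \<omega> = t} \<in> null_sets M"
proof -
  define \<S> where "\<S> = {A \<in> sets M. A \<subseteq> F}"
  have fm: "A \<in> fmeasurable M" if "A \<in> sets M" "A \<subseteq> F" for A
    using that F by (meson fmeasurableI2)
  have "\<exists>B\<in>sets M. B \<subseteq> A \<and> measure M B \<le> measure M A / 2 \<and>
      (\<forall>C\<in>sets M. C \<subseteq> A \<and> measure M C \<le> measure M A / 2 \<longrightarrow> measure M C \<le> 2 * measure M B)"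
    if A: "A \<in> \<S>" for A
  proof -
    define R where "R = {C \<in> sets M. C \<subseteq> A \<and> measure M C \<le> measure M A / 2}"
    have ne: "R \<noteq> {}" by (auto simp: R_def intro: exI[of _ "{}"])
    have bdd: "bdd_above (measure M ` R)"
      by (rule bdd_aboveI2[where M = "measure M A / 2"]) (simp add: R_def)
    define s where "s = (SUP C\<in>R. measure M C)"
    have up: "measure M C \<le> s" if "C \<in> R" for C
      unfolding s_def using that bdd by (rule cSUP_upper)
    \<comment> \<open>The supremum need not be attained; the factor two leaves room below it. If it
      is not positive, the empty set will do.\<close>
    obtain B where B: "B \<in> R" "s \<le> 2 * measure M B"
    proof (cases "s > 0")
      case True
      then have "\<exists>B\<in>R. s / 2 < measure M B"
        using less_cSUP_iff[OF ne bdd, of "s / 2"] by (simp add: s_def)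
      then show thesis using that by force
    next
      case False
      then show thesis using that[of "{}"] by (auto simp: R_def)
    qed
    have "measure M C \<le> 2 * measure M B" if "C \<in> R" for C
      using up[OF that] B(2) by linarith
    then show ?thesis
      using B(1) unfolding R_def by blast
  qed
  then obtain B where B: "\<And>A. A \<in> \<S> \<Longrightarrow> B A \<in> sets M" "\<And>A. A \<in> \<S> \<Longrightarrow> B A \<subseteq> A"
      "\<And>A. A \<in> \<S> \<Longrightarrow> measure M (B A) \<le> measure M A / 2"
      "\<And>A C. A \<in> \<S> \<Longrightarrow> C \<in> sets M \<Longrightarrow> C \<subseteq> A \<Longrightarrow> measure M C \<le> measure M A / 2 \<Longrightarrow>
        measure M C \<le> 2 * measure M (B A)"
    by metis
  let ?c = "cell B F"
  have cS: "?c \<omega> n \<in> \<S>" for \<omega> n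
    using F B(1,2) by (induction n) (auto simp: \<S>_def)
  have fin: "finite (range (\<lambda>\<omega>. ?c \<omega> n))" for n
  proof (induction n)
    case (Suc n)
    have "range (\<lambda>\<omega>. ?c \<omega> (Suc n)) \<subseteq>
        B ` range (\<lambda>\<omega>. ?c \<omega> n) \<union> (\<lambda>C. C - B C) ` range (\<lambda>\<omega>. ?c \<omega> n)"
      by auto
    then show ?case by (rule finite_subset) (use Suc in auto)
  qed simp
  \<comment> \<open>Membership in \<open>D n\<close> records the turn taken at depth
    \<open>n\<close>. There are finitely many cells per depth, so \<open>D n\<close> is
    measurable.\<close>
  define D where "D n = (\<Union>\<omega>\<in>UNIV. B (?c \<omega> n))" for n
  have Dsets: "D n \<in> sets M" for n
  proof -
    have "D n = \<Union>(B ` range (\<lambda>\<omega>. ?c \<omega> n))" by (auto simp: D_def)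
    also have "\<dots> \<in> sets M" using fin[of n] B(1) cS by (intro sets.finite_Union) auto
    finally show ?thesis .
  qed
  have D_iff: "\<omega> \<in> D n \<longleftrightarrow> \<omega> \<in> B (?c \<omega> n)" for \<omega> n
  proof
    assume "\<omega> \<in> D n"
    then obtain \<omega>' where w': "\<omega> \<in> B (?c \<omega>' n)" by (auto simp: D_def)
    then have "?c \<omega> n = ?c \<omega>' n" using B(2) cS by (intro cell_eq[of \<S>]) auto
    with w' show "\<omega> \<in> B (?c \<omega> n)" by simp
  qed (auto simp: D_def)
  define f where "f \<omega> = ternary (\<lambda>n. \<omega> \<in> D n)" for \<omega>
  have meas: "f \<in> borel_measurable M"
  proof -
    have "f = (\<lambda>\<omega>. \<Sum>n. indicator (D n) \<omega> / 3 ^ Suc n)"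
      by (auto simp: f_def ternary_def indicator_def of_bool_def)
    also have "\<dots> \<in> borel_measurable M" using Dsets by measurable
    finally show ?thesis .
  qed
  have "{\<omega> \<in> F. f \<omega> = t} \<in> null_sets M" for t
  proof -
    define L where "L = {\<omega> \<in> F. f \<omega> = t}"
    have L: "L \<in> sets M" "L \<subseteq> F"
    proof -
      have "L = F \<inter> (f -` {t} \<inter> space M)"
        using F sets.sets_into_space[of F M] by (auto simp: L_def fmeasurable_def)
      also have "\<dots> \<in> sets M" using F meas by auto
      finally show "L \<in> sets M" .
    qed (auto simp: L_def)
    have "measure M L = 0"
    proof (rule ccontr)
      assume "measure M L \<noteq> 0"
      then have pos: "0 < measure M L" using measure_nonneg[of M L] by linarith
      obtain C where C: "C \<in> sets M" "C \<subseteq> L" "0 < measure M C" "measure M C \<le> measure M L / 2"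
        using atomless_small_subset[OF F atomless L pos] by metis
      obtain \<omega> where w: "\<omega> \<in> L" using pos by (cases "L = {}") auto
      \<comment> \<open>Equal values of \<open>f\<close> mean equal bits, hence equal turns: the
        level set stays in one cell at every depth.\<close>
      have Lc: "L \<subseteq> ?c \<omega> n" for n
      proof
        fix \<omega>' assume w': "\<omega>' \<in> L"
        then have "ternary (\<lambda>n. \<omega>' \<in> D n) = ternary (\<lambda>n. \<omega> \<in> D n)"
          using w by (simp add: L_def f_def)
        then have bit: "(\<omega>' \<in> D m) = (\<omega> \<in> D m)" for m by (rule ternary_inject)
        have "?c \<omega>' m = ?c \<omega> m" for m
        proof (induction m)
          case (Suc m)
          then show ?case using bit[of m] D_iff[of \<omega> m] D_iff[of \<omega>' m] by simp
        qed simp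
        then show "\<omega>' \<in> ?c \<omega> n" using cell_mem[of \<omega>' F B n] w' L by auto
      qed
      \<comment> \<open>\<open>C\<close> has at most half the measure of \<open>L\<close>, hence of
        the cell, so it competed in the choice of \<open>B ?A\<close>. The remainder therefore lacks
        at least half the measure of \<open>C\<close>, and so does \<open>B ?A\<close>, which has at
        most half the measure of the cell.\<close>
      have step: "measure M (?c \<omega> (Suc n)) \<le> measure M (?c \<omega> n) - measure M C / 2" for n
      proof -
        let ?A = "?c \<omega> n"
        have A: "?A \<in> \<S>" "?A \<in> fmeasurable M" "B ?A \<in> fmeasurable M"
          using cS[of \<omega> n] B(1,2)[OF cS[of \<omega> n]] by (auto simp: \<S>_def intro!: fm)
        have "measure M L \<le> measure M ?A" using Lc L A by (intro measure_mono_fmeasurable) auto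
        then have "measure M C \<le> 2 * measure M (B ?A)"
          using C Lc[of n] by (intro B(4) A) auto
        moreover have "measure M (?A - B ?A) = measure M ?A - measure M (B ?A)"
          using A B(1,2)[OF A(1)] by (intro measurable_measure_Diff) auto
        ultimately show ?thesis using B(3)[OF A(1)] by auto
      qed
      have decay: "measure M (?c \<omega> n) \<le> measure M F - real n * (measure M C / 2)" for n
      proof (induction n)
        case (Suc n)
        have "real (Suc n) * (measure M C / 2) = real n * (measure M C / 2) + measure M C / 2"
          by (simp add: algebra_simps)
        with Suc step[of n] show ?case by linarith
      qed simp
      have "0 < measure M C / 2" using C(3) by simp
      from reals_Archimedean3[OF this]
      obtain n where "measure M F < real n * (measure M C / 2)" by blast
      with decay[of n] measure_nonneg[of M "?c \<omega> n"] show False by linarith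
    qed
    then show ?thesis
      using emeasure_eq_measure2[OF fm[OF L]] L(1) unfolding L_def by (intro null_setsI) simp_all
  qed
  moreover have "0 \<le> f \<omega>" "f \<omega> \<le> 1" for \<omega>
    using ternary_bounds[of "\<lambda>n. \<omega> \<in> D n"] by (auto simp: f_def)
  ultimately show thesis using meas by (intro that)
qed

section \<open>Equality cases of the triangle inequality\<close>

text \<open>A loss in the triangle inequality over \<open>J\<close> persists over \<open>I\<close>,
  because the terms outside \<open>J\<close> cannot make up for it.\<close>

lemma norm_sum_eq_subset:
  fixes v :: "'i \<Rightarrow> 'b::real_normed_vector"
  assumes "finite I" "J \<subseteq> I" "norm (\<Sum>i\<in>I. v i) = (\<Sum>i\<in>I. norm (v i))"
  shows "norm (\<Sum>i\<in>J. v i) = (\<Sum>i\<in>J. norm (v i))"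
proof -
  have "norm (\<Sum>i\<in>I. v i) \<le> norm (\<Sum>i\<in>I - J. v i) + norm (\<Sum>i\<in>J. v i)"
    unfolding sum.subset_diff[OF assms(2,1)] by (rule norm_triangle_ineq)
  moreover have "(\<Sum>i\<in>I. norm (v i)) = (\<Sum>i\<in>I - J. norm (v i)) + (\<Sum>i\<in>J. norm (v i))"
    by (rule sum.subset_diff[OF assms(2,1)])
  moreover have "norm (\<Sum>i\<in>I - J. v i) \<le> (\<Sum>i\<in>I - J. norm (v i))" "norm (\<Sum>i\<in>J. v i) \<le> (\<Sum>i\<in>J. norm (v i))"
    by (rule norm_sum)+
  ultimately show ?thesis using assms(3) by linarith
qed

text \<open>Tonelli: the sum of the norms has a finite integral and is therefore finite almost
  everywhere.\<close>

lemma AE_summable_norm: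
  fixes f :: "nat \<Rightarrow> 'a \<Rightarrow> 'b::{banach, second_countable_topology}"
  assumes int: "\<And>i. integrable M (f i)" and sum: "summable (\<lambda>i. \<integral>\<omega>. norm (f i \<omega>) \<partial>M)"
  shows "AE \<omega> in M. summable (\<lambda>i. norm (f i \<omega>))"
proof -
  have meas: "f i \<in> borel_measurable M" for i using int by auto
  have "(\<integral>\<^sup>+\<omega>. (\<Sum>i. ennreal (norm (f i \<omega>))) \<partial>M) = (\<Sum>i. \<integral>\<^sup>+\<omega>. ennreal (norm (f i \<omega>)) \<partial>M)"
    using meas by (intro nn_integral_suminf) measurable
  also have "\<dots> = (\<Sum>i. ennreal (\<integral>\<omega>. norm (f i \<omega>) \<partial>M))"
    using int by (intro suminf_cong nn_integral_eq_integral) auto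
  also have "\<dots> \<noteq> \<infinity>"
    using sum by (simp add: ennreal_suminf_neq_top)
  finally have "AE \<omega> in M. (\<Sum>i. ennreal (norm (f i \<omega>))) \<noteq> \<infinity>"
    using meas by (intro nn_integral_PInf_AE) measurable
  then show ?thesis
    by eventually_elim (auto intro: summable_suminf_not_top)
qed

text \<open>Equality case of the triangle inequality for scalars, transported along the isometric
  isomorphism with the reals or the complex numbers. In the complex case the two norm equations,
  squared and subtracted, force real part one.\<close>

lemma real_or_complex_eq_one:
  fixes c :: "'k::real_or_complex"
  assumes "norm c = 1" "norm (1 + c) = 2"
  shows "c = 1"
proof -
  \<comment> \<open>The image of \<open>1\<close> is an idempotent of norm one in a field.\<close>
  have one: "\<phi> 1 = 1" if mult: "\<And>x y. \<phi> (x * y) = \<phi> x * \<phi> y" and nrm: "\<And>x. norm (\<phi> x) = norm x"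
    for \<phi> :: "'k \<Rightarrow> 'b::real_normed_field"
    using mult[of 1 1] nrm[of 1] by auto
  from real_or_complex[where 'a = 'k] show ?thesis
  proof (elim disjE exE conjE)
    fix \<phi> :: "'k \<Rightarrow> real"
    assume \<phi>: "bij \<phi>" "\<forall>x y. \<phi> (x + y) = \<phi> x + \<phi> y" "\<forall>x y. \<phi> (x * y) = \<phi> x * \<phi> y"
      "\<forall>x. norm (\<phi> x) = norm x"
    have "\<bar>\<phi> c\<bar> = 1" "\<bar>1 + \<phi> c\<bar> = 2"
      using \<phi>(2,4) one[of \<phi>] \<phi>(3,4) assms by (metis real_norm_def)+
    then have "\<phi> c = \<phi> 1" using one[of \<phi>] \<phi>(3,4) by auto
    with \<phi>(1) show "c = 1" by (auto dest: bij_is_inj injD)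
  next
    fix \<phi> :: "'k \<Rightarrow> complex"
    assume \<phi>: "bij \<phi>" "\<forall>x y. \<phi> (x + y) = \<phi> x + \<phi> y" "\<forall>x y. \<phi> (x * y) = \<phi> x * \<phi> y"
      "\<forall>x. norm (\<phi> x) = norm x"
    define z where "z = \<phi> c"
    have "cmod z = 1" "cmod (1 + z) = 2"
      using \<phi>(2,4) one[of \<phi>] \<phi>(3,4) assms unfolding z_def by metis+
    then have "(Re z)\<^sup>2 + (Im z)\<^sup>2 = 1" "(1 + Re z)\<^sup>2 + (Im z)\<^sup>2 = 4"
      using cmod_power2[of z] cmod_power2[of "1 + z"] by auto
    moreover from this have "Re z = 1"
      by (simp add: power2_eq_square algebra_simps)
    ultimately have "Re z = 1" "Im z = 0" by simp_all
    then have "\<phi> c = \<phi> 1" using one[of \<phi>] \<phi>(3,4) by (simp add: complex_eq_iff z_def)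
    with \<phi>(1) show "c = 1" by (auto dest: bij_is_inj injD)
  qed
qed

text \<open>For \<open>t \<ge> 1 / 2\<close>, adding \<open>2 * t - 1\<close> times the unit vector
  \<open>b\<close> to the convex combination gives \<open>t *\<^sub>R (a + b)\<close>, of norm at
  least \<open>2 * t\<close>; so the combination has norm at least one. Exchanging \<open>a\<close>
  and \<open>b\<close> covers \<open>t < 1 / 2\<close>.\<close>

lemma norm_convex_combination_eq_one:
  fixes a b :: "'b::real_normed_vector"
  assumes unit: "norm a = 1" "norm b = 1" "2 \<le> norm (a + b)" and t: "0 \<le> t" "t \<le> 1"
  shows "norm (t *\<^sub>R a + (1 - t) *\<^sub>R b) = 1"
proof (rule antisym)
  have ge: "1 \<le> norm (t *\<^sub>R a + (1 - t) *\<^sub>R b)"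
    if "norm a = 1" "norm b = 1" "2 \<le> norm (a + b)" "1 / 2 \<le> t" "t \<le> 1" for a b :: 'b and t
  proof -
    have "t * norm (a + b) = norm (t *\<^sub>R (a + b))"
      using that by simp
    also have "t *\<^sub>R (a + b) = (t *\<^sub>R a + (1 - t) *\<^sub>R b) + (2 * t - 1) *\<^sub>R b"
      by (simp add: algebra_simps flip: scaleR_add_left)
    also have "norm \<dots> \<le> norm (t *\<^sub>R a + (1 - t) *\<^sub>R b) + (2 * t - 1)"
      using norm_triangle_ineq[of "t *\<^sub>R a + (1 - t) *\<^sub>R b" "(2 * t - 1) *\<^sub>R b"] that
      by simp
    finally have "t * norm (a + b) \<le> norm (t *\<^sub>R a + (1 - t) *\<^sub>R b) + (2 * t - 1)" .
    moreover have "t * 2 \<le> t * norm (a + b)"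
      using that by (intro mult_left_mono) auto
    ultimately show ?thesis by linarith
  qed
  show "1 \<le> norm (t *\<^sub>R a + (1 - t) *\<^sub>R b)"
  proof (cases "1 / 2 \<le> t")
    case True
    then show ?thesis using ge[of a b t] assms by blast
  next
    case False
    then show ?thesis using ge[of b a "1 - t"] assms by (simp add: add.commute)
  qed
  show "norm (t *\<^sub>R a + (1 - t) *\<^sub>R b) \<le> 1"
    using norm_triangle_ineq[of "t *\<^sub>R a" "(1 - t) *\<^sub>R b"] assms by simp
qed

section \<open>The projective norm as an \<open>L\<^sub>1\<close> norm\<close>

locale banach_scaling =
  fixes sm :: "'k::real_or_complex \<Rightarrow> 'y::banach \<Rightarrow> 'y"
  assumes banach_scale: "banach_scale sm"
begin

sublocale vector_space sm
  using banach_scale by (simp add: banach_scale_def)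

lemma scale_of_real: "sm (of_real r) y = r *\<^sub>R y"
  using banach_scale by (simp add: banach_scale_def)

lemma norm_scale: "norm (sm c y) = norm c * norm y"
  using banach_scale by (simp add: banach_scale_def)

lemma continuous_scale [continuous_intros]:
  assumes "continuous_on S f"
  shows "continuous_on S (\<lambda>v. sm (f v) y)"
proof -
  have "(norm y)-lipschitz_on UNIV (\<lambda>c. sm c y)"
    by (rule lipschitz_onI)
      (simp_all add: dist_norm norm_scale mult.commute flip: scale_left_diff_distrib)
  then have "continuous_on UNIV (\<lambda>c. sm c y)"
    by (rule lipschitz_on_continuous_on)
  then show ?thesis
    using assms by (rule continuous_on_compose2) simp
qed

lemma sums_scale_left:
  assumes "f sums s"
  shows "(\<lambda>i. sm (f i) y) sums sm s y"
proof -
  have "isCont (\<lambda>c. sm c y) s"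
    using continuous_scale[OF continuous_on_id, of UNIV y]
    by (simp add: continuous_on_eq_continuous_at)
  then have "(\<lambda>n. sm (\<Sum>i<n. f i) y) \<longlonglongrightarrow> sm s y"
    using assms unfolding sums_def by (rule isCont_tendsto_compose)
  then show ?thesis by (simp add: sums_def scale_sum_left)
qed

end

locale L1_tensor = banach_scaling sm for sm :: "'k::real_or_complex \<Rightarrow> 'y::banach \<Rightarrow> 'y" +
  fixes M :: "'a measure"
begin

abbreviation X :: "('k, 'a \<Rightarrow> 'k) space" where "X \<equiv> L1 M"
abbreviation Y :: "('k, 'y) space" where "Y \<equiv> whole_space sm"
abbreviation tens where "tens \<equiv> tensor X Y"
abbreviation pn where "pn \<equiv> alg_proj_norm X Y"

lemma space_simps [simp]:
  "f \<in> car X \<longleftrightarrow> integrable M f" "nrm X f = (\<integral>\<omega>. norm (f \<omega>) \<partial>M)" "scal X c f = (\<lambda>\<omega>. c * f \<omega>)"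
  "y \<in> car Y" "nrm Y y = norm y" "scal Y c y = sm c y"
  by (simp_all add: L1_def whole_space_def)

lemma tens_add_left:
  "integrable M f \<Longrightarrow> integrable M g \<Longrightarrow> tens (\<lambda>\<omega>. f \<omega> + g \<omega>) y = tens f y + tens g y"
  by (auto simp: tensor_def bilinear_form_def fun_eq_iff plus_fun_def)

lemma tens_add_right: "integrable M f \<Longrightarrow> tens f (y + z) = tens f y + tens f z"
  by (auto simp: tensor_def bilinear_form_def fun_eq_iff)

lemma tens_scale: "integrable M f \<Longrightarrow> tens (\<lambda>\<omega>. c * f \<omega>) y = tens f (sm c y)"
  by (auto simp: tensor_def bilinear_form_def fun_eq_iff)

lemma tens_null: "integrable M f \<Longrightarrow> (\<integral>\<omega>. norm (f \<omega>) \<partial>M) = 0 \<Longrightarrow> tens f y = 0"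
  by (auto simp: tensor_def bilinear_form_def fun_eq_iff)

lemma tens_zero_left [simp]: "tens (\<lambda>\<omega>. 0) y = 0"
  by (rule tens_null) simp_all

lemma tens_zero_right: "integrable M f \<Longrightarrow> tens f 0 = 0"
  using tens_add_right[of f 0 0] by simp

lemma tens_uminus_right: "integrable M f \<Longrightarrow> tens f (- y) = - tens f y"
  using tens_add_right[of f y "- y"] tens_zero_right[of f] by (simp add: eq_neg_iff_add_eq_0 add.commute)

lemma tens_sum_left:
  assumes "\<And>v. v \<in> V \<Longrightarrow> integrable M (g v)"
  shows "tens (\<lambda>\<omega>. \<Sum>v\<in>V. a v * g v \<omega>) y = (\<Sum>v\<in>V. tens (g v) (sm (a v) y))"
  using assms by (induction V rule: infinite_finite_induct) (simp_all add: tens_add_left tens_scale)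

lemma tens_sum_right: "integrable M f \<Longrightarrow> tens f (\<Sum>i\<in>I. y i) = (\<Sum>i\<in>I. tens f (y i))"
  by (induction I rule: infinite_finite_induct) (simp_all add: tens_add_right tens_zero_right)

text \<open>The coefficients differ by an element of norm zero, which every
  \<open>bilinear_form\<close> annihilates.\<close>

lemma tens_cong:
  assumes "integrable M f" "integrable M g" "AE \<omega> in M. f \<omega> = g \<omega>"
  shows "tens f y = tens g y"
proof -
  have "(\<integral>\<omega>. norm (f \<omega> - g \<omega>) \<partial>M) = (\<integral>\<omega>. 0 \<partial>M)"
    by (rule integral_cong_AE) (use assms in auto)
  then have "tens (\<lambda>\<omega>. f \<omega> - g \<omega>) y = 0"
    using assms by (intro tens_null) auto
  moreover have "tens f y = tens (\<lambda>\<omega>. (f \<omega> - g \<omega>) + g \<omega>) y" by simp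
  ultimately show ?thesis
    using assms by (simp only: tens_add_left Bochner_Integration.integrable_diff) simp
qed

text \<open>A finite decomposition of the tensor \<open>t\<close>, together with the \<open>Y\<close>-valued function \<open>F\<close> that it
  represents and the cost \<open>c\<close> entering the infimum in the projective norm.\<close>

definition decomp :: "((('a \<Rightarrow> 'k) \<Rightarrow> 'y \<Rightarrow> 'k) \<Rightarrow> 'k) \<Rightarrow> ('a \<Rightarrow> 'y) \<Rightarrow> real \<Rightarrow> bool" where
  "decomp t F c \<longleftrightarrow> (\<exists>(n::nat) f y. (\<forall>i. integrable M (f i)) \<and> t = (\<Sum>i<n. tens (f i) (y i)) \<and>
     F = (\<lambda>\<omega>. \<Sum>i<n. sm (f i \<omega>) (y i)) \<and> c = (\<Sum>i<n. (\<integral>\<omega>. norm (f i \<omega>) \<partial>M) * norm (y i)))"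

lemma decompI:
  assumes "finite I" and int: "\<And>i. i \<in> I \<Longrightarrow> integrable M (f i)"
  shows "decomp (\<Sum>i\<in>I. tens (f i) (y i)) (\<lambda>\<omega>. \<Sum>i\<in>I. sm (f i \<omega>) (y i))
    (\<Sum>i\<in>I. (\<integral>\<omega>. norm (f i \<omega>) \<partial>M) * norm (y i))"
proof -
  obtain h where h: "bij_betw h {..<card I} I"
    using ex_bij_betw_nat_finite[OF \<open>finite I\<close>] by (auto simp: lessThan_atLeast0)
  define f' where "f' i = (if i < card I then f (h i) else (\<lambda>_. 0))" for i
  have "\<forall>i. integrable M (f' i)"
    using int h by (auto simp: f'_def bij_betw_def)
  then show ?thesis
    unfolding decomp_def
    by (intro exI[of _ "card I"] exI[of _ f'] exI[of _ "\<lambda>i. y (h i)"])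
      (simp add: sum.reindex_bij_betw[OF h, symmetric] f'_def)
qed

lemma decomp_add:
  assumes "decomp t F c" "decomp t' F' c'"
  shows "decomp (t + t') (\<lambda>\<omega>. F \<omega> + F' \<omega>) (c + c')"
proof -
  obtain n f y where 1: "\<And>i::nat. integrable M (f i)" "t = (\<Sum>i<n. tens (f i) (y i))"
    "F = (\<lambda>\<omega>. \<Sum>i<n. sm (f i \<omega>) (y i))" "c = (\<Sum>i<n. (\<integral>\<omega>. norm (f i \<omega>) \<partial>M) * norm (y i))"
    using assms(1) unfolding decomp_def by blast
  obtain n' f' y' where 2: "\<And>i::nat. integrable M (f' i)" "t' = (\<Sum>i<n'. tens (f' i) (y' i))"
    "F' = (\<lambda>\<omega>. \<Sum>i<n'. sm (f' i \<omega>) (y' i))"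
    "c' = (\<Sum>i<n'. (\<integral>\<omega>. norm (f' i \<omega>) \<partial>M) * norm (y' i))"
    using assms(2) unfolding decomp_def by blast
  \<comment> \<open>The disjoint sum of the index sets concatenates the two decompositions.\<close>
  have "decomp (\<Sum>i\<in>{..<n} <+> {..<n'}. tens (case_sum f f' i) (case_sum y y' i))
      (\<lambda>\<omega>. \<Sum>i\<in>{..<n} <+> {..<n'}. sm (case_sum f f' i \<omega>) (case_sum y y' i))
      (\<Sum>i\<in>{..<n} <+> {..<n'}. (\<integral>\<omega>. norm (case_sum f f' i \<omega>) \<partial>M) * norm (case_sum y y' i))"
    by (rule decompI) (auto simp: 1(1) 2(1))
  then show ?thesis by (simp add: sum.Plus 1 2)
qed

lemma decomp_uminus:
  assumes "decomp t F c"
  shows "decomp (- t) (\<lambda>\<omega>. - F \<omega>) c"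
proof -
  obtain n f y where 1: "\<And>i::nat. integrable M (f i)" "t = (\<Sum>i<n. tens (f i) (y i))"
    "F = (\<lambda>\<omega>. \<Sum>i<n. sm (f i \<omega>) (y i))" "c = (\<Sum>i<n. (\<integral>\<omega>. norm (f i \<omega>) \<partial>M) * norm (y i))"
    using assms unfolding decomp_def by blast
  show ?thesis
    using decompI[of "{..<n}" f "\<lambda>i. - y i"] by (simp add: 1 tens_uminus_right sum_negf)
qed

lemma decomp_diff:
  assumes "decomp t F c" "decomp t' F' c'"
  shows "decomp (t - t') (\<lambda>\<omega>. F \<omega> - F' \<omega>) (c + c')"
  using decomp_add[OF assms(1) decomp_uminus[OF assms(2)]] by simp

text \<open>\<open>Y\<close> need not be separable, so measurability is not obtained by adding
  measurable functions. Instead \<open>F\<close> factors through the sequence of its scalar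
  coefficients, which depends measurably on \<omega>, followed by a continuous map into
  \<open>Y\<close>.\<close>

lemma decomp_measurable:
  assumes "decomp t F c"
  shows "F \<in> borel_measurable M"
proof -
  obtain n f y where 1: "\<And>i::nat. integrable M (f i)" "F = (\<lambda>\<omega>. \<Sum>i<n. sm (f i \<omega>) (y i))"
    using assms unfolding decomp_def by blast
  have "(\<lambda>\<omega> i. f i \<omega>) \<in> borel_measurable M"
    using 1(1) by (intro measurable_coordinatewise_then_product) auto
  moreover have "(\<lambda>v. \<Sum>i<n. sm (v i) (y i)) \<in> borel_measurable borel"
    by (intro borel_measurable_continuous_onI continuous_intros) auto
  ultimately show ?thesis
    unfolding 1(2) by (rule measurable_compose)
qed

text \<open>The triangle inequality, integrated. Integrability is claimed for the real function
  \<open>norm (F \<omega>)\<close> only, as \<open>Y\<close> need not be second countable.\<close>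

lemma decomp_integrable:
  assumes "decomp t F c"
  shows "integrable M (\<lambda>\<omega>. norm (F \<omega>))" "(\<integral>\<omega>. norm (F \<omega>) \<partial>M) \<le> c"
proof -
  obtain n f y where 1: "\<And>i::nat. integrable M (f i)" "F = (\<lambda>\<omega>. \<Sum>i<n. sm (f i \<omega>) (y i))"
    "c = (\<Sum>i<n. (\<integral>\<omega>. norm (f i \<omega>) \<partial>M) * norm (y i))"
    using assms unfolding decomp_def by blast
  have le: "norm (F \<omega>) \<le> (\<Sum>i<n. norm (f i \<omega>) * norm (y i))" for \<omega>
    unfolding 1(2) using norm_sum[of "\<lambda>i. sm (f i \<omega>) (y i)" "{..<n}"] by (simp add: norm_scale)
  have int: "integrable M (\<lambda>\<omega>. \<Sum>i<n. norm (f i \<omega>) * norm (y i))"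
    using 1(1) by auto
  show *: "integrable M (\<lambda>\<omega>. norm (F \<omega>))"
  proof (rule Bochner_Integration.integrable_bound[OF int])
    show "AE \<omega> in M. norm (norm (F \<omega>)) \<le> norm (\<Sum>i<n. norm (f i \<omega>) * norm (y i))"
      using le by (intro AE_I2) (auto intro: order_trans abs_ge_self)
  qed (use decomp_measurable[OF assms] in measurable)
  have "(\<integral>\<omega>. norm (F \<omega>) \<partial>M) \<le> (\<integral>\<omega>. (\<Sum>i<n. norm (f i \<omega>) * norm (y i)) \<partial>M)"
    using * int le by (rule integral_mono)
  also have "\<dots> = c"
    using 1(1) by (simp add: 1(3))
  finally show "(\<integral>\<omega>. norm (F \<omega>) \<partial>M) \<le> c" .
qed

text \<open>Coordinates in a Hamel basis of \<open>Y\<close> and integration against the conjugate sign of a coordinate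
  yield bilinear forms which detect that the function is null.\<close>

lemma decomp_zero_AE:
  assumes "decomp 0 F c"
  shows "AE \<omega> in M. F \<omega> = 0"
proof -
  obtain n f y where 1: "\<And>i::nat. integrable M (f i)" "0 = (\<Sum>i<n. tens (f i) (y i))"
    "F = (\<lambda>\<omega>. \<Sum>i<n. sm (f i \<omega>) (y i))"
    using assms unfolding decomp_def by blast
  define E where "E = extend_basis {}"
  have E: "independent E" "span E = UNIV"
    unfolding E_def by (simp_all add: independent_extend_basis independent_empty)
  define \<phi> where "\<phi> b v = representation E v b" for b v
  have \<phi>_add: "\<phi> b (v + w) = \<phi> b v + \<phi> b w" and \<phi>_scale: "\<phi> b (sm c v) = c * \<phi> b v" for b v w c
    using E by (simp_all add: \<phi>_def representation_add representation_scale)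
  have \<phi>_zero: "\<phi> b 0 = 0" for b
    by (simp add: \<phi>_def representation_zero)
  have \<phi>_sum: "\<phi> b (\<Sum>i\<in>I. v i) = (\<Sum>i\<in>I. \<phi> b (v i))" for b I and v :: "nat \<Rightarrow> 'y"
    by (induction I rule: infinite_finite_induct) (simp_all add: \<phi>_add \<phi>_zero)
  have \<phi>_F: "\<phi> b (F \<omega>) = (\<Sum>i<n. f i \<omega> * \<phi> b (y i))" for b \<omega>
    by (simp add: 1(3) \<phi>_sum \<phi>_scale)
  \<comment> \<open>Only finitely many coordinates occur in the values of \<open>F\<close>, so that
    the null sets of the single coordinates can be united.\<close>
  define S where "S = (\<Union>i<n. {b. \<phi> b (y i) \<noteq> 0})"
  have S: "finite S"
    unfolding S_def \<phi>_def by (auto intro: finite_representation)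
  have "AE \<omega> in M. \<phi> b (F \<omega>) = 0" for b
  proof -
    define G where "G \<omega> = \<phi> b (F \<omega>)" for \<omega>
    have G: "integrable M G"
      using 1(1) by (auto simp: G_def[abs_def] \<phi>_F)
    \<comment> \<open>The conjugate sign of \<open>G\<close>; by \<open>inverse 0 = 0\<close> it
      vanishes where \<open>G\<close> does.\<close>
    define h where "h \<omega> = of_real (norm (G \<omega>)) * inverse (G \<omega>)" for \<omega>
    have hG: "h \<omega> * G \<omega> = of_real (norm (G \<omega>))" and h_le: "norm (h \<omega>) \<le> 1" for \<omega>
      by (cases "G \<omega> = 0"; simp add: h_def norm_mult norm_inverse)+
    have h_meas: "h \<in> borel_measurable M"
      using G unfolding h_def by measurable
    have h_int: "integrable M (\<lambda>\<omega>. h \<omega> * g \<omega>)" if "integrable M g" for g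
      by (rule Bochner_Integration.integrable_bound[OF that])
        (use that h_meas h_le in \<open>auto simp: norm_mult mult_left_le_one_le\<close>)
    \<comment> \<open>The coordinate \<open>\<phi> b\<close> may be discontinuous, which
      \<open>bilinear_form\<close> permits.\<close>
    define B where "B g v = (\<integral>\<omega>. h \<omega> * g \<omega> \<partial>M) * \<phi> b v" for g v
    have "bilinear_form X Y B"
    proof -
      have "(\<integral>\<omega>. h \<omega> * g \<omega> \<partial>M) = 0" if g: "integrable M g" "(\<integral>\<omega>. norm (g \<omega>) \<partial>M) = 0" for g
      proof -
        have "AE \<omega> in M. norm (g \<omega>) = 0"
          using g by (subst integral_nonneg_eq_0_iff_AE[symmetric]) auto
        then have "(\<integral>\<omega>. h \<omega> * g \<omega> \<partial>M) = (\<integral>\<omega>. 0 \<partial>M)"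
          using g h_meas by (intro integral_cong_AE) auto
        then show ?thesis by simp
      qed
      moreover have "(\<integral>\<omega>. h \<omega> * (c * g \<omega>) \<partial>M) = c * (\<integral>\<omega>. h \<omega> * g \<omega> \<partial>M)" for c g
        by (simp add: mult.left_commute)
      ultimately show ?thesis
        by (auto simp: bilinear_form_def B_def \<phi>_add \<phi>_scale \<phi>_zero h_int plus_fun_def
            distrib_left distrib_right mult.assoc intro: mult.left_commute)
    qed
    then have "0 = (\<Sum>i<n. B (f i) (y i))"
    proof -
      assume B: "bilinear_form X Y B"
      have "(\<Sum>i<k. tens (f i) (y i)) B = (\<Sum>i<k. B (f i) (y i))" for k
        by (induction k) (simp_all add: tensor_def B)
      from this[of n] show ?thesis by (simp flip: 1(2))
    qed
    also have "\<dots> = (\<integral>\<omega>. (\<Sum>i<n. h \<omega> * f i \<omega> * \<phi> b (y i)) \<partial>M)"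
      unfolding B_def using 1(1) h_int by (subst Bochner_Integration.integral_sum) auto
    also have "\<dots> = (\<integral>\<omega>. h \<omega> * G \<omega> \<partial>M)"
      by (simp add: G_def \<phi>_F sum_distrib_left mult.assoc)
    also have "\<dots> = of_real (\<integral>\<omega>. norm (G \<omega>) \<partial>M)"
      unfolding hG using G by (intro integral_bounded_linear bounded_linear_of_real) auto
    finally have "(\<integral>\<omega>. norm (G \<omega>) \<partial>M) = 0" by simp
    then have "AE \<omega> in M. norm (G \<omega>) = 0"
      using G by (subst integral_nonneg_eq_0_iff_AE[symmetric]) auto
    then show ?thesis by (simp add: G_def)
  qed
  then have "AE \<omega> in M. \<forall>b\<in>S. \<phi> b (F \<omega>) = 0"
    using S by (intro AE_finite_allI) auto
  then show ?thesis
  proof eventually_elim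
    case (elim \<omega>)
    have "\<phi> b (F \<omega>) = 0" for b
      using elim by (cases "b \<in> S") (auto simp: S_def \<phi>_F)
    moreover have "F \<omega> = (\<Sum>b | representation E (F \<omega>) b \<noteq> 0. sm (representation E (F \<omega>) b) b)"
      using E by (intro sum_nonzero_representation_eq[symmetric]) auto
    ultimately show "F \<omega> = 0" by (simp add: \<phi>_def)
  qed
qed

lemma decomp_unique:
  assumes "decomp t F c" "decomp t G d"
  shows "AE \<omega> in M. F \<omega> = G \<omega>"
  using decomp_zero_AE[of "\<lambda>\<omega>. F \<omega> - G \<omega>"] decomp_diff[OF assms] by simp

lemma decomp_integral_unique:
  assumes "decomp t F c" "decomp t G d"
  shows "(\<integral>\<omega>. norm (F \<omega>) \<partial>M) = (\<integral>\<omega>. norm (G \<omega>) \<partial>M)"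
  using decomp_unique[OF assms] decomp_integrable(1)[OF assms(1)] decomp_integrable(1)[OF assms(2)]
  by (intro integral_cong_AE) auto

text \<open>Approximability by simple functions in the integral of the norm is part of the
  definition of the Bochner integral.\<close>

lemma integrable_simple_approx:
  fixes f :: "'a \<Rightarrow> 'k"
  assumes "integrable M f" "e > 0"
  obtains s where "Bochner_Integration.simple_bochner_integrable M s" "(\<integral>\<omega>. norm (f \<omega> - s \<omega>) \<partial>M) < e"
proof -
  obtain x where "has_bochner_integral M f x"
    using assms(1) by (auto simp: integrable.simps)
  then obtain s where s: "\<And>i. Bochner_Integration.simple_bochner_integrable M (s i)"
    "(\<lambda>i. \<integral>\<^sup>+\<omega>. norm (f \<omega> - s i \<omega>) \<partial>M) \<longlonglongrightarrow> 0"
    by (rule has_bochner_integral.cases) blast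
  from s(2) have "\<forall>\<^sub>F i in sequentially. (\<integral>\<^sup>+\<omega>. norm (f \<omega> - s i \<omega>) \<partial>M) < ennreal e"
    using assms(2) by (intro order_tendstoD) auto
  then obtain i where i: "(\<integral>\<^sup>+\<omega>. norm (f \<omega> - s i \<omega>) \<partial>M) < ennreal e"
    by (meson eventually_sequentially order_refl)
  have "integrable M (s i)"
    using has_bochner_integral_simple_bochner_integrable[OF s(1)] by (rule integrable.intros)
  then have "ennreal (\<integral>\<omega>. norm (f \<omega> - s i \<omega>) \<partial>M) = (\<integral>\<^sup>+\<omega>. norm (f \<omega> - s i \<omega>) \<partial>M)"
    using assms(1) by (intro nn_integral_eq_integral[symmetric]) auto
  with i have "ennreal (\<integral>\<omega>. norm (f \<omega> - s i \<omega>) \<partial>M) < ennreal e"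
    by simp
  then have "(\<integral>\<omega>. norm (f \<omega> - s i \<omega>) \<partial>M) < e"
    by (simp add: ennreal_less_iff)
  with s(1) show thesis by (rule that)
qed

text \<open>On the common level sets of the simple coefficients the tensor is a sum of elementary tensors
  with disjoint supports, and its cost in this form is the \<open>L\<^sub>1\<close> norm.\<close>

lemma decomp_simple:
  fixes y :: "nat \<Rightarrow> 'y"
  assumes s: "\<And>i. i < n \<Longrightarrow> Bochner_Integration.simple_bochner_integrable M (s i)"
  obtains F where "decomp (\<Sum>i<n. tens (s i) (y i)) F (\<integral>\<omega>. norm (\<Sum>i<n. sm (s i \<omega>) (y i)) \<partial>M)"
proof -
  have simple: "simple_function M (s i)" and fin: "emeasure M {\<omega>\<in>space M. s i \<omega> \<noteq> 0} \<noteq> \<infinity>"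
    and int: "integrable M (s i)" if "i < n" for i
    using s[OF that] has_bochner_integral_simple_bochner_integrable[OF s[OF that]]
    by (auto simp: simple_bochner_integrable.simps integrable.simps)
  define g where "g \<omega> = map (\<lambda>i. s i \<omega>) [0..<n]" for \<omega>
  have g_nth: "g \<omega> ! i = s i \<omega>" if "i < n" for \<omega> i
    using that by (simp add: g_def)
  \<comment> \<open>The zero list is left out: its level set may have infinite measure, and the
    tensor receives nothing from it.\<close>
  define V where "V = g ` space M - {replicate n 0}"
  define A where "A v = {\<omega> \<in> space M. g \<omega> = v}" for v
  define ind :: "'k list \<Rightarrow> 'a \<Rightarrow> 'k" where "ind v = indicator (A v)" for v
  define z where "z v = (\<Sum>i<n. sm (v ! i) (y i))" for v
  have V: "finite V"
  proof -
    have "g ` space M \<subseteq> {l. set l \<subseteq> (\<Union>i<n. s i ` space M) \<and> length l = n}"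
      by (auto simp: g_def intro!: bexI imageI)
    moreover have "finite (\<Union>i<n. s i ` space M)"
      using simple by (auto simp: simple_function_def)
    ultimately show ?thesis
      unfolding V_def using finite_lists_length_eq finite_subset by blast
  qed
  have A_sets: "A v \<in> sets M" if "length v = n" for v
  proof -
    have "A v = {\<omega> \<in> space M. \<forall>i\<in>{..<n}. s i \<omega> = v ! i}"
      using that by (auto simp: A_def g_def list_eq_iff_nth_eq)
    also have "\<dots> \<in> sets M"
    proof (intro sets.sets_Collect_finite_All)
      fix i assume "i \<in> {..<n}"
      then have "{\<omega> \<in> space M. s i \<omega> = v ! i} = s i -` {v ! i} \<inter> space M" "simple_function M (s i)"
        using simple by auto
      then show "{\<omega> \<in> space M. s i \<omega> = v ! i} \<in> sets M"
        by (simp add: simple_functionD)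
    qed simp
    finally show ?thesis .
  qed
  have ind_int: "integrable M (ind v)" if v: "v \<in> V" for v
  proof -
    have len: "length v = n" using v by (auto simp: V_def g_def)
    have "\<exists>i<n. v ! i \<noteq> 0"
      using v len by (auto simp: V_def list_eq_iff_nth_eq)
    then obtain i where i: "i < n" "v ! i \<noteq> 0" by blast
    have "A v \<subseteq> {\<omega>\<in>space M. s i \<omega> \<noteq> 0}"
      using i by (auto simp: A_def g_nth)
    moreover have "{\<omega>\<in>space M. s i \<omega> \<noteq> 0} \<in> sets M"
      using int[OF i(1)] by measurable
    ultimately have "emeasure M (A v) < \<infinity>"
      using fin[OF i(1)] emeasure_mono by (metis infinity_ennreal_def less_top order.strict_trans1)
    then have "integrable M (\<lambda>\<omega>. indicator (A v) \<omega> *\<^sub>R (1::'k))"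
      using A_sets[OF len] by (intro integrable_indicator)
    also have "(\<lambda>\<omega>. indicator (A v) \<omega> *\<^sub>R (1::'k)) = ind v"
      by (auto simp: ind_def indicator_def)
    finally show ?thesis .
  qed
  have sum_ind: "(\<Sum>v\<in>V. a v * ind v \<omega>) = (if g \<omega> \<in> V then a (g \<omega>) else 0)"
    if "\<omega> \<in> space M" for a \<omega>
  proof -
    have "(\<Sum>v\<in>V. a v * ind v \<omega>) = (\<Sum>v\<in>V. if g \<omega> = v then a v else 0)"
      using that by (intro sum.cong) (auto simp: ind_def A_def)
    then show ?thesis using V by simp
  qed
  have not_V: "s i \<omega> = 0" if "\<omega> \<in> space M" "g \<omega> \<notin> V" "i < n" for \<omega> i
    using that g_nth[of i \<omega>] by (auto simp: V_def)
  have "tens (s i) (y i) = (\<Sum>v\<in>V. tens (ind v) (sm (v ! i) (y i)))" if "i < n" for i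
  proof -
    have "tens (s i) (y i) = tens (\<lambda>\<omega>. \<Sum>v\<in>V. v ! i * ind v \<omega>) (y i)"
      using that int ind_int not_V by (intro tens_cong) (auto intro!: AE_I2 simp: sum_ind g_nth)
    then show ?thesis by (simp add: tens_sum_left ind_int)
  qed
  then have "(\<Sum>i<n. tens (s i) (y i)) = (\<Sum>i<n. \<Sum>v\<in>V. tens (ind v) (sm (v ! i) (y i)))"
    by simp
  also have "\<dots> = (\<Sum>v\<in>V. tens (ind v) (z v))"
    by (subst sum.swap) (simp add: z_def tens_sum_right ind_int)
  finally have t: "(\<Sum>i<n. tens (s i) (y i)) = (\<Sum>v\<in>V. tens (ind v) (z v))" .
  have "(\<integral>\<omega>. norm (\<Sum>i<n. sm (s i \<omega>) (y i)) \<partial>M) = (\<integral>\<omega>. (\<Sum>v\<in>V. norm (ind v \<omega>) * norm (z v)) \<partial>M)"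
  proof (rule Bochner_Integration.integral_cong)
    fix \<omega> assume \<omega>: "\<omega> \<in> space M"
    have "(\<Sum>v\<in>V. norm (ind v \<omega>) * norm (z v)) = (\<Sum>v\<in>V. if g \<omega> = v then norm (z v) else 0)"
      using \<omega> by (intro sum.cong) (auto simp: ind_def A_def)
    also have "\<dots> = (if g \<omega> \<in> V then norm (z (g \<omega>)) else 0)" using V by simp
    also have "\<dots> = norm (\<Sum>i<n. sm (s i \<omega>) (y i))"
      using not_V[OF \<omega>] by (auto simp: z_def g_nth)
    finally show "norm (\<Sum>i<n. sm (s i \<omega>) (y i)) = (\<Sum>v\<in>V. norm (ind v \<omega>) * norm (z v))" ..
  qed simp
  also have "\<dots> = (\<Sum>v\<in>V. (\<integral>\<omega>. norm (ind v \<omega>) \<partial>M) * norm (z v))"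
    using ind_int by simp
  finally show thesis
    using that[of "\<lambda>\<omega>. \<Sum>v\<in>V. sm (ind v \<omega>) (z v)"] decompI[OF V, of ind z] ind_int t by simp
qed

text \<open>Nearby simple coefficients split \<open>t\<close> into a simple part, with a
  decomposition that costs no more than its \<open>L\<^sub>1\<close> norm, and a remainder of small
  cost \<open>r\<close>. The norm of the simple part exceeds that of \<open>F\<close> by at most
  \<open>r\<close>, so \<open>r\<close> enters twice and is kept below \<open>e / 2\<close>.\<close>

lemma decomp_near_optimal:
  assumes "decomp t F c" "e > 0"
  obtains G d where "decomp t G d" "d < (\<integral>\<omega>. norm (F \<omega>) \<partial>M) + e"
proof -
  obtain f y n where 1: "\<And>i::nat. integrable M (f i)" "t = (\<Sum>i<n. tens (f i) (y i))"
    "F = (\<lambda>\<omega>. \<Sum>i<n. sm (f i \<omega>) (y i))"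
    using assms(1) unfolding decomp_def by blast
  \<comment> \<open>The summand \<open>1\<close> keeps the denominator positive and makes the bound
    on the cost of the remainder strict.\<close>
  define \<delta> where "\<delta> = e / (2 * (1 + (\<Sum>i<n. norm (y i))))"
  have Spos: "0 < 1 + (\<Sum>i<n. norm (y i))"
    by (intro add_pos_nonneg sum_nonneg) auto
  then have \<delta>: "\<delta> > 0" "\<delta> * (\<Sum>i<n. norm (y i)) < e / 2"
    using assms(2) by (auto simp: \<delta>_def field_simps)
  have "\<exists>s. Bochner_Integration.simple_bochner_integrable M s \<and> (\<integral>\<omega>. norm (f i \<omega> - s \<omega>) \<partial>M) < \<delta>" for i
    using integrable_simple_approx[OF 1(1) \<delta>(1)] by metis
  then obtain s where s: "\<And>i. Bochner_Integration.simple_bochner_integrable M (s i)"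
    "\<And>i. (\<integral>\<omega>. norm (f i \<omega> - s i \<omega>) \<partial>M) < \<delta>" by metis
  have s_int: "integrable M (s i)" for i
    using has_bochner_integral_simple_bochner_integrable[OF s(1)] by (rule integrable.intros)
  define H where "H \<omega> = (\<Sum>i<n. sm (s i \<omega>) (y i))" for \<omega>
  obtain G where G: "decomp (\<Sum>i<n. tens (s i) (y i)) G (\<integral>\<omega>. norm (H \<omega>) \<partial>M)"
    using decomp_simple[of n s y] s(1) unfolding H_def by blast
  define r where "r = (\<Sum>i<n. (\<integral>\<omega>. norm (f i \<omega> - s i \<omega>) \<partial>M) * norm (y i))"
  have "r \<le> (\<Sum>i<n. \<delta> * norm (y i))"
    unfolding r_def using s(2) by (intro sum_mono mult_right_mono) (auto intro: less_imp_le)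
  with \<delta>(2) have r: "r < e / 2" by (simp add: sum_distrib_left)
  have rest: "decomp (\<Sum>i<n. tens (\<lambda>\<omega>. f i \<omega> - s i \<omega>) (y i))
      (\<lambda>\<omega>. \<Sum>i<n. sm (f i \<omega> - s i \<omega>) (y i)) r"
    unfolding r_def using 1(1) s_int by (intro decompI) auto
  have "tens (f i) (y i) = tens (\<lambda>\<omega>. f i \<omega> - s i \<omega>) (y i) + tens (s i) (y i)" for i
    using tens_add_left[of "\<lambda>\<omega>. f i \<omega> - s i \<omega>" "s i" "y i"] 1(1) s_int by simp
  then have t: "t = (\<Sum>i<n. tens (\<lambda>\<omega>. f i \<omega> - s i \<omega>) (y i)) + (\<Sum>i<n. tens (s i) (y i))"
    by (simp add: 1(2) sum.distrib)
  have H: "decomp (\<Sum>i<n. tens (s i) (y i)) H (\<Sum>i<n. (\<integral>\<omega>. norm (s i \<omega>) \<partial>M) * norm (y i))"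
    unfolding H_def[abs_def] using s_int by (intro decompI) auto
  have "(\<integral>\<omega>. norm (H \<omega>) \<partial>M) \<le> (\<integral>\<omega>. norm (F \<omega>) + norm (F \<omega> - H \<omega>) \<partial>M)"
  proof (rule integral_mono)
    show "integrable M (\<lambda>\<omega>. norm (F \<omega>) + norm (F \<omega> - H \<omega>))"
      using decomp_integrable(1)[OF assms(1)] decomp_integrable(1)[OF decomp_diff[OF assms(1) H]]
      by (rule Bochner_Integration.integrable_add)
    show "norm (H \<omega>) \<le> norm (F \<omega>) + norm (F \<omega> - H \<omega>)" for \<omega>
      using norm_triangle_ineq4[of "F \<omega>" "F \<omega> - H \<omega>"] by simp
  qed (rule decomp_integrable(1)[OF H])
  also have "\<dots> = (\<integral>\<omega>. norm (F \<omega>) \<partial>M) + (\<integral>\<omega>. norm (F \<omega> - H \<omega>) \<partial>M)"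
    using decomp_integrable(1)[OF assms(1)] decomp_integrable(1)[OF decomp_diff[OF assms(1) H]]
    by (rule Bochner_Integration.integral_add)
  also have "(\<integral>\<omega>. norm (F \<omega> - H \<omega>) \<partial>M) \<le> r"
    using decomp_integrable(2)[OF rest]
    by (simp add: 1(3) H_def scale_left_diff_distrib flip: sum_subtractf)
  finally have "r + (\<integral>\<omega>. norm (H \<omega>) \<partial>M) < (\<integral>\<omega>. norm (F \<omega>) \<partial>M) + e"
    using r by linarith
  then show thesis
    using that decomp_add[OF rest G] unfolding t by blast
qed

text \<open>No decomposition costs less than the \<open>L\<^sub>1\<close> norm, which is the same
  for all functions representing \<open>t\<close>, and near-optimal decompositions come arbitrarily
  close to it.\<close>

lemma alg_proj_norm_eq:
  assumes "decomp t F c"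
  shows "pn t = (\<integral>\<omega>. norm (F \<omega>) \<partial>M)"
proof -
  have pn: "pn t = Inf {d. \<exists>G. decomp t G d}"
    unfolding alg_proj_norm_def decomp_def by (rule arg_cong[where f = Inf]) auto
  have lower: "(\<integral>\<omega>. norm (F \<omega>) \<partial>M) \<le> d" if "decomp t G d" for G d
    using decomp_integral_unique[OF assms that] decomp_integrable(2)[OF that] by simp
  show ?thesis
  proof (rule antisym)
    show "(\<integral>\<omega>. norm (F \<omega>) \<partial>M) \<le> pn t"
      unfolding pn using assms lower by (intro cInf_greatest) auto
    show "pn t \<le> (\<integral>\<omega>. norm (F \<omega>) \<partial>M)"
    proof (rule field_le_epsilon)
      fix e :: real assume "e > 0"
      then obtain G d where G: "decomp t G d" "d < (\<integral>\<omega>. norm (F \<omega>) \<partial>M) + e"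
        using decomp_near_optimal[OF assms] by metis
      have "pn t \<le> d"
        unfolding pn using G(1) lower by (intro cInf_lower) (auto intro!: bdd_belowI)
      with G(2) show "pn t \<le> (\<integral>\<omega>. norm (F \<omega>) \<partial>M) + e" by simp
    qed
  qed
qed

section \<open>The completion\<close>

abbreviation part :: "(nat \<Rightarrow> 'a \<Rightarrow> 'k) \<Rightarrow> (nat \<Rightarrow> 'y) \<Rightarrow> nat \<Rightarrow> (('a \<Rightarrow> 'k) \<Rightarrow> 'y \<Rightarrow> 'k) \<Rightarrow> 'k" where
  "part f y n \<equiv> \<Sum>i<n. tens (f i) (y i)"

lemma alg_tensor_iff: "t \<in> alg_tensor X Y \<longleftrightarrow> (\<exists>F c. decomp t F c)"
  by (simp add: alg_tensor_def decomp_def) blast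

lemma decomp_part:
  assumes "\<And>i. integrable M (f i)"
  shows "decomp (part f y n) (\<lambda>\<omega>. \<Sum>i<n. sm (f i \<omega>) (y i))
    (\<Sum>i<n. (\<integral>\<omega>. norm (f i \<omega>) \<partial>M) * norm (y i))"
  using assms by (intro decompI) auto

lemma part_in_alg_tensor: "(\<And>i. integrable M (f i)) \<Longrightarrow> part f y n \<in> alg_tensor X Y"
  using decomp_part alg_tensor_iff by blast

lemma alg_tensor_diff: "s \<in> alg_tensor X Y \<Longrightarrow> t \<in> alg_tensor X Y \<Longrightarrow> s - t \<in> alg_tensor X Y"
  unfolding alg_tensor_iff using decomp_diff by blast

lemma pn_nonneg: "t \<in> alg_tensor X Y \<Longrightarrow> 0 \<le> pn t"
  unfolding alg_tensor_iff using alg_proj_norm_eq by fastforce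

lemma pn_squeeze:
  assumes "\<And>n. t n \<in> alg_tensor X Y" "\<And>n. pn (t n) \<le> b n" "b \<longlonglongrightarrow> 0"
  shows "(\<lambda>n. pn (t n)) \<longlonglongrightarrow> 0"
  by (rule tendsto_sandwich[OF _ _ tendsto_const assms(3)]) (simp_all add: assms pn_nonneg)

lemma pn_add_le:
  assumes "s \<in> alg_tensor X Y" "t \<in> alg_tensor X Y"
  shows "pn (s + t) \<le> pn s + pn t"
proof -
  obtain F c G d where *: "decomp s F c" "decomp t G d"
    using assms by (auto simp: alg_tensor_iff)
  have int: "integrable M (\<lambda>\<omega>. norm (F \<omega>))" "integrable M (\<lambda>\<omega>. norm (G \<omega>))"
    using * by (auto intro: decomp_integrable)
  have "pn (s + t) = (\<integral>\<omega>. norm (F \<omega> + G \<omega>) \<partial>M)"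
    by (rule alg_proj_norm_eq[OF decomp_add[OF *]])
  also have "\<dots> \<le> (\<integral>\<omega>. norm (F \<omega>) + norm (G \<omega>) \<partial>M)"
    using int decomp_integrable(1)[OF decomp_add[OF *]]
    by (intro integral_mono norm_triangle_ineq) auto
  also have "\<dots> = pn s + pn t"
    using int by (simp add: alg_proj_norm_eq[OF *(1)] alg_proj_norm_eq[OF *(2)])
  finally show ?thesis .
qed

lemma pn_minus_commute:
  assumes "s \<in> alg_tensor X Y" "t \<in> alg_tensor X Y"
  shows "pn (s - t) = pn (t - s)"
proof -
  obtain F c G d where *: "decomp s F c" "decomp t G d"
    using assms by (auto simp: alg_tensor_iff)
  show ?thesis
    by (simp add: alg_proj_norm_eq[OF decomp_diff[OF *]] alg_proj_norm_eq[OF decomp_diff[OF *(2,1)]]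
        norm_minus_commute)
qed

lemma pn_triangle:
  assumes "r \<in> alg_tensor X Y" "s \<in> alg_tensor X Y" "t \<in> alg_tensor X Y"
  shows "pn (r - t) \<le> pn (r - s) + pn (s - t)"
  using pn_add_le[of "r - s" "s - t"] assms by (simp add: alg_tensor_diff)

lemma pn_diff_le:
  assumes "s \<in> alg_tensor X Y" "t \<in> alg_tensor X Y"
  shows "\<bar>pn s - pn t\<bar> \<le> pn (s - t)"
  using pn_add_le[of "s - t" t] pn_add_le[of "t - s" s] pn_minus_commute[OF assms] assms
  by (simp add: alg_tensor_diff)

lemma pn_zero: "pn 0 = 0"
  using alg_proj_norm_eq[OF decompI[of "{}"]] by simp

text \<open>Two members of a class are compared through the sequence \<open>W\<close> that generates
  it.\<close>

lemma proj_tensor_equivD: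
  assumes "u \<in> proj_tensor X Y" "U \<in> u" "V \<in> u"
  shows "U \<in> tensor_Cauchy X Y" "(\<lambda>n. pn (U n - V n)) \<longlonglongrightarrow> 0"
proof -
  obtain W where W: "(W, U) \<in> tensor_equiv X Y" "(W, V) \<in> tensor_equiv X Y"
    using assms by (auto simp: proj_tensor_def quotient_def)
  then show "U \<in> tensor_Cauchy X Y" by (simp add: tensor_equiv_def)
  from W have mem: "W n \<in> alg_tensor X Y" "U n \<in> alg_tensor X Y" "V n \<in> alg_tensor X Y" for n
    by (auto simp: tensor_equiv_def tensor_Cauchy_def)
  have "(\<lambda>n. pn (W n - U n) + pn (W n - V n)) \<longlonglongrightarrow> 0"
    using W by (auto simp: tensor_equiv_def intro: tendsto_add_zero)
  moreover have "pn (U n - V n) \<le> pn (W n - U n) + pn (W n - V n)" for n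
    using pn_triangle[of "U n" "W n" "V n"] pn_minus_commute[of "W n" "U n"] mem by simp
  ultimately show "(\<lambda>n. pn (U n - V n)) \<longlonglongrightarrow> 0"
    by (intro pn_squeeze alg_tensor_diff mem)
qed

text \<open>Serves to replace one series representing \<open>u\<close> by another. The Cauchy
  property passes from \<open>W\<close> to \<open>V\<close> by an estimate in three terms.\<close>

lemma proj_tensor_memI:
  assumes u: "u \<in> proj_tensor X Y" "U \<in> u" and V: "\<And>n. V n \<in> alg_tensor X Y"
    and lim: "(\<lambda>n. pn (U n - V n)) \<longlonglongrightarrow> 0"
  shows "V \<in> u"
proof -
  obtain W where W: "u = tensor_equiv X Y `` {W}" "W \<in> tensor_Cauchy X Y"
    using u by (auto simp: proj_tensor_def quotient_def)
  then have WU: "(\<lambda>n. pn (W n - U n)) \<longlonglongrightarrow> 0" and mem: "W n \<in> alg_tensor X Y" "U n \<in> alg_tensor X Y" for n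
    using u(2) by (auto simp: tensor_equiv_def tensor_Cauchy_def)
  have le: "pn (W n - V n) \<le> pn (W n - U n) + pn (U n - V n)" for n
    using pn_triangle mem V by blast
  have WV: "(\<lambda>n. pn (W n - V n)) \<longlonglongrightarrow> 0"
    by (rule pn_squeeze[OF alg_tensor_diff[OF mem(1) V] le tendsto_add_zero[OF WU lim]])
  have "\<exists>N. \<forall>m\<ge>N. \<forall>n\<ge>N. pn (V m - V n) < e" if "e > 0" for e
  proof -
    have e: "e / 3 > 0" using that by simp
    obtain N1 where N1: "\<And>m n. m \<ge> N1 \<Longrightarrow> n \<ge> N1 \<Longrightarrow> pn (W m - W n) < e / 3"
      using W(2) e unfolding tensor_Cauchy_def by blast
    obtain N2 where N2: "\<And>n. n \<ge> N2 \<Longrightarrow> pn (W n - V n) < e / 3"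
      using order_tendstoD(2)[OF WV e] unfolding eventually_sequentially by blast
    have "pn (V m - V n) < e" if "m \<ge> max N1 N2" "n \<ge> max N1 N2" for m n
      using pn_triangle[OF V[of m] mem(1)[of m] V[of n]] pn_triangle[OF mem(1)[of m] mem(1)[of n] V[of n]]
        pn_minus_commute[OF V[of m] mem(1)[of m]] N1[of m n] N2[of m] N2[of n] that by simp
    then show ?thesis by blast
  qed
  then have "V \<in> tensor_Cauchy X Y"
    using V by (auto simp: tensor_Cauchy_def)
  with W WV show ?thesis by (auto simp: tensor_equiv_def)
qed

lemma proj_tensor_classI:
  assumes "U \<in> tensor_Cauchy X Y"
  shows "tensor_equiv X Y `` {U} \<in> proj_tensor X Y" "U \<in> tensor_equiv X Y `` {U}"
  using assms by (auto simp: proj_tensor_def quotient_def tensor_equiv_def pn_zero)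

text \<open>Justifies the definite description in \<open>proj_norm\<close>: the norms along a
  representative form a Cauchy sequence, whose limit is common to all representatives.\<close>

lemma proj_norm_tendsto:
  assumes "u \<in> proj_tensor X Y" "U \<in> u"
  shows "(\<lambda>n. pn (U n)) \<longlonglongrightarrow> proj_norm X Y u"
proof -
  have U: "U \<in> tensor_Cauchy X Y" using proj_tensor_equivD[OF assms assms(2)] by blast
  then have mem: "U n \<in> alg_tensor X Y" for n by (simp add: tensor_Cauchy_def)
  have "Cauchy (\<lambda>n. pn (U n))"
  proof (rule metric_CauchyI)
    fix e :: real assume "e > 0"
    then obtain N where N: "\<And>m n. m \<ge> N \<Longrightarrow> n \<ge> N \<Longrightarrow> pn (U m - U n) < e"
      using U unfolding tensor_Cauchy_def by blast
    have "dist (pn (U m)) (pn (U n)) < e" if "m \<ge> N" "n \<ge> N" for m n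
      using pn_diff_le[OF mem[of m] mem[of n]] N[OF that] by (simp add: dist_real_def)
    then show "\<exists>N. \<forall>m\<ge>N. \<forall>n\<ge>N. dist (pn (U m)) (pn (U n)) < e" by blast
  qed
  then obtain r where r: "(\<lambda>n. pn (U n)) \<longlonglongrightarrow> r"
    by (auto simp: Cauchy_convergent_iff convergent_def)
  have all: "(\<lambda>n. pn (V n)) \<longlonglongrightarrow> r" if "V \<in> u" for V
  proof -
    have memV: "V n \<in> alg_tensor X Y" for n
      using proj_tensor_equivD(1)[OF assms(1) that that] by (simp add: tensor_Cauchy_def)
    have "(\<lambda>n. pn (V n) - pn (U n)) \<longlonglongrightarrow> 0"
    proof (rule tendsto_0_le[where K = 1, OF _ always_eventually])
      show "\<forall>n. norm (pn (V n) - pn (U n)) \<le> norm (pn (V n - U n)) * 1"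
        using order_trans[OF pn_diff_le[OF memV mem] abs_ge_self] by simp
    qed (rule proj_tensor_equivD(2)[OF assms(1) that assms(2)])
    from tendsto_add[OF this r] show ?thesis by simp
  qed
  have "proj_norm X Y u = r"
    unfolding proj_norm_def
    by (rule the_equality) (use all assms(2) r LIMSEQ_unique in blast)+
  with r show ?thesis by simp
qed

section \<open>Disjointly supported tensors\<close>

lemma supp_inter_null_iff:
  assumes "integrable M f" "integrable M g"
  shows "emeasure M (supp M f \<inter> supp M g) = 0 \<longleftrightarrow> (AE \<omega> in M. f \<omega> = 0 \<or> g \<omega> = 0)"
proof (rule AE_iff_measurable[symmetric])
  show "{\<omega> \<in> space M. \<not> (f \<omega> = 0 \<or> g \<omega> = 0)} = supp M f \<inter> supp M g"
    by (auto simp: supp_def)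
  have "{\<omega> \<in> space M. f \<omega> \<noteq> 0 \<and> g \<omega> \<noteq> 0} \<in> sets M"
    using assms by measurable
  then show "supp M f \<inter> supp M g \<in> sets M"
    unfolding supp_def by (rule back_subst) auto
qed

lemma disjoint_tensorsE:
  assumes "u \<in> disjoint_tensors M Y"
  obtains f y where "u \<in> proj_tensor X Y" "\<And>i. integrable M (f i)" "part f y \<in> u"
    "AE \<omega> in M. \<forall>i j. i \<noteq> j \<longrightarrow> f i \<omega> = 0 \<or> f j \<omega> = 0"
proof -
  obtain f y where u: "u \<in> proj_tensor X Y" and fy: "tensor_sums X Y f y u"
    and disj: "\<And>i j. i \<noteq> j \<Longrightarrow> emeasure M (supp M (f i) \<inter> supp M (f j)) = 0"
    using assms unfolding disjoint_tensors_def by blast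
  have int: "integrable M (f i)" and "part f y \<in> u" for i
    using fy by (auto simp: tensor_sums_def)
  moreover have "AE \<omega> in M. i \<noteq> j \<longrightarrow> f i \<omega> = 0 \<or> f j \<omega> = 0" for i j
    using disj[of i j] supp_inter_null_iff[OF int[of i] int[of j]] by (cases "i = j") auto
  then have "AE \<omega> in M. \<forall>i j. i \<noteq> j \<longrightarrow> f i \<omega> = 0 \<or> f j \<omega> = 0"
    by (simp only: AE_all_countable simp_thms)
  ultimately show thesis using u that by blast
qed

text \<open>At almost every point at most one term is nonzero, so the norm of a partial sum is the
  sum of the norms of its terms. Every partial sum thus has projective norm equal to its
  cost.\<close>

lemma disjoint_subset_NA: "disjoint_tensors M Y \<subseteq> NA_proj X Y"
proof
  fix u assume "u \<in> disjoint_tensors M Y"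
  then obtain f y where u: "u \<in> proj_tensor X Y" and int: "\<And>i. integrable M (f i)" and mem: "part f y \<in> u"
    and disj: "AE \<omega> in M. \<forall>i j. i \<noteq> j \<longrightarrow> f i \<omega> = 0 \<or> f j \<omega> = 0"
    by (rule disjoint_tensorsE) blast
  have norm_sum_disjoint: "norm (\<Sum>i\<in>I. v i) = (\<Sum>i\<in>I. norm (v i))"
    if "finite I" "\<And>i j. i \<noteq> j \<Longrightarrow> v i = 0 \<or> v j = 0" for I :: "nat set" and v :: "nat \<Rightarrow> 'y"
    using that(1)
  proof (induction I)
    case (insert i I)
    show ?case
    proof (cases "v i = 0")
      case False
      then have "v j = 0" if "j \<in> I" for j
        using insert.hyps that(1) \<open>\<And>i j. i \<noteq> j \<Longrightarrow> v i = 0 \<or> v j = 0\<close>[of i j] by auto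
      then show ?thesis using insert.hyps by simp
    qed (use insert in simp)
  qed simp
  have "pn (part f y n) = (\<Sum>i<n. nrm X (f i) * nrm Y (y i))" for n
  proof -
    have "pn (part f y n) = (\<integral>\<omega>. norm (\<Sum>i<n. sm (f i \<omega>) (y i)) \<partial>M)"
      by (rule alg_proj_norm_eq[OF decomp_part[OF int]])
    also have "\<dots> = (\<integral>\<omega>. (\<Sum>i<n. norm (f i \<omega>) * norm (y i)) \<partial>M)"
    proof (rule integral_cong_AE)
      show "AE \<omega> in M. norm (\<Sum>i<n. sm (f i \<omega>) (y i)) = (\<Sum>i<n. norm (f i \<omega>) * norm (y i))"
        using disj
      proof eventually_elim
        case (elim \<omega>)
        then have "sm (f i \<omega>) (y i) = 0 \<or> sm (f j \<omega>) (y j) = 0" if "i \<noteq> j" for i j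
          using that by fastforce
        then show ?case
          by (subst norm_sum_disjoint) (auto simp: norm_scale)
      qed
    qed (use decomp_integrable(1)[OF decomp_part[OF int]] int in auto)
    finally show ?thesis using int by simp
  qed
  then have "(\<lambda>i. nrm X (f i) * nrm Y (y i)) sums proj_norm X Y u"
    using proj_norm_tendsto[OF u mem] by (simp add: sums_def)
  with u int mem show "u \<in> NA_proj X Y"
    unfolding NA_proj_def tensor_sums_def by auto
qed

section \<open>The converse inclusion for strictly convex spaces\<close>

lemma strictly_convex_iff:
  "strictly_convex Y \<longleftrightarrow> (\<forall>a b :: 'y. norm a = 1 \<and> norm b = 1 \<and> a \<noteq> b \<longrightarrow> norm (a + b) < 2)"
  by (simp add: strictly_convex_def Ball_def)

text \<open>If \<open>norm a \<le> norm b\<close>, then \<open>a + b\<close> is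
  \<open>norm a\<close> times the sum of the two normalized vectors plus an excess in the direction
  of \<open>b\<close>. Distinct normalized vectors would make the first summand shorter than
  \<open>2 * norm a\<close>.\<close>

lemma strictly_convex_norm_add:
  fixes a b :: 'y
  assumes sc: "strictly_convex Y" and nz: "a \<noteq> 0" "b \<noteq> 0" and eq: "norm (a + b) = norm a + norm b"
  shows "a /\<^sub>R norm a = b /\<^sub>R norm b"
  using nz eq
proof (induction "norm a" "norm b" arbitrary: a b rule: linorder_wlog)
  case (le a b)
  define a' b' where "a' = a /\<^sub>R norm a" and "b' = b /\<^sub>R norm b"
  have unit: "norm a' = 1" "norm b' = 1" using le by (simp_all add: a'_def b'_def)
  show ?case
  proof (rule ccontr)
    assume "a /\<^sub>R norm a \<noteq> b /\<^sub>R norm b"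
    then have "norm (a' + b') < 2"
      using sc unit unfolding strictly_convex_iff a'_def b'_def by blast
    then have "norm a * norm (a' + b') < norm a * 2"
      using le by (intro mult_strict_left_mono) auto
    moreover have "a + b = norm a *\<^sub>R (a' + b') + (norm b - norm a) *\<^sub>R b'"
      using le by (simp add: a'_def b'_def algebra_simps)
    then have "norm (a + b) \<le> norm a * norm (a' + b') + (norm b - norm a)"
      using norm_triangle_ineq[of "norm a *\<^sub>R (a' + b')" "(norm b - norm a) *\<^sub>R b'"] unit le(1) by simp
    ultimately show False using le by linarith
  qed
next
  case (sym a b)
  then show ?case by (metis add.commute)
qed

text \<open>The terms of an optimal representation add up without cancellation, so by strict convexity
  the \<open>y i\<close> whose coefficients are nonzero at a common point are proportional. Merging
  the terms of each class of proportional vectors into the first one therefore makes the supports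
  disjoint.\<close>

lemma NA_subset_disjoint:
  assumes sc: "strictly_convex Y"
  shows "NA_proj X Y \<subseteq> disjoint_tensors M Y"
proof
  fix u assume "u \<in> NA_proj X Y"
  then obtain f y where u: "u \<in> proj_tensor X Y" and int: "\<And>i. integrable M (f i)" and mem: "part f y \<in> u"
    and opt: "(\<lambda>i. (\<integral>\<omega>. norm (f i \<omega>) \<partial>M) * norm (y i)) sums proj_norm X Y u"
    unfolding NA_proj_def tensor_sums_def by auto

  \<comment> \<open>Absence of cancellation\<close>
  define v where "v i \<omega> = sm (f i \<omega>) (y i)" for i \<omega>
  \<comment> \<open>The loss in the triangle inequality. It is nonnegative and grows with
    \<open>n\<close>, while optimality sends its integrals to zero; hence all of them
    vanish.\<close>
  define T where "T n \<omega> = (\<Sum>i<n. norm (v i \<omega>)) - norm (\<Sum>i<n. v i \<omega>)" for n \<omega>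
  have T_nonneg: "0 \<le> T n \<omega>" for n \<omega>
    unfolding T_def by (simp add: norm_sum)
  have T_mono: "T n \<omega> \<le> T (Suc n) \<omega>" for n \<omega>
    unfolding T_def using norm_triangle_ineq[of "\<Sum>i<n. v i \<omega>" "v n \<omega>"] by simp
  have norm_v: "norm (v i \<omega>) = norm (f i \<omega>) * norm (y i)" for i \<omega>
    by (simp add: v_def norm_scale)
  have int_v: "integrable M (\<lambda>\<omega>. norm (v i \<omega>))" for i
    unfolding norm_v using int by auto
  have int_S: "integrable M (\<lambda>\<omega>. norm (\<Sum>i<n. v i \<omega>))" for n
    unfolding v_def by (rule decomp_integrable(1)[OF decomp_part[OF int]])
  have int_T: "integrable M (T n)" for n
    unfolding T_def[abs_def] using int_v int_S by (intro Bochner_Integration.integrable_diff Bochner_Integration.integrable_sum)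
  have "(\<integral>\<omega>. T n \<omega> \<partial>M) = (\<Sum>i<n. (\<integral>\<omega>. norm (f i \<omega>) \<partial>M) * norm (y i)) - pn (part f y n)" for n
  proof -
    have "(\<integral>\<omega>. T n \<omega> \<partial>M) = (\<integral>\<omega>. (\<Sum>i<n. norm (v i \<omega>)) \<partial>M) - (\<integral>\<omega>. norm (\<Sum>i<n. v i \<omega>) \<partial>M)"
      unfolding T_def using int_v int_S
      by (intro Bochner_Integration.integral_diff Bochner_Integration.integrable_sum)
    moreover have "pn (part f y n) = (\<integral>\<omega>. norm (\<Sum>i<n. v i \<omega>) \<partial>M)"
      unfolding v_def by (rule alg_proj_norm_eq[OF decomp_part[OF int]])
    moreover have "(\<integral>\<omega>. (\<Sum>i<n. norm (v i \<omega>)) \<partial>M) = (\<Sum>i<n. (\<integral>\<omega>. norm (f i \<omega>) \<partial>M) * norm (y i))"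
      using int_v int by (subst Bochner_Integration.integral_sum) (auto simp: norm_v)
    ultimately show ?thesis by simp
  qed
  then have "(\<lambda>n. \<integral>\<omega>. T n \<omega> \<partial>M) \<longlonglongrightarrow> proj_norm X Y u - proj_norm X Y u"
    using opt proj_norm_tendsto[OF u mem] by (simp only: sums_def tendsto_diff)
  moreover have "incseq (\<lambda>n. \<integral>\<omega>. T n \<omega> \<partial>M)"
    using int_T T_mono by (intro incseq_SucI integral_mono) auto
  ultimately have "(\<integral>\<omega>. T n \<omega> \<partial>M) \<le> 0" for n
    using incseq_le by fastforce
  moreover have "0 \<le> (\<integral>\<omega>. T n \<omega> \<partial>M)" for n
    using T_nonneg by (intro Bochner_Integration.integral_nonneg) auto
  ultimately have "(\<integral>\<omega>. T n \<omega> \<partial>M) = 0" for n by (simp add: antisym)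
  then have "AE \<omega> in M. T n \<omega> = 0" for n
    using int_T T_nonneg by (subst integral_nonneg_eq_0_iff_AE[symmetric]) auto
  then have T_AE: "AE \<omega> in M. \<forall>n. T n \<omega> = 0"
    by (simp add: AE_all_countable)

  \<comment> \<open>Classes of proportional vectors\<close>
  define related where "related i j \<longleftrightarrow> (\<exists>c. y j = sm c (y i))" for i j
  \<comment> \<open>\<open>related\<close> is not symmetric, since the zero vector is a multiple of
    every vector; every \<open>j\<close> with \<open>y j = 0\<close> has
    \<open>L j = 0\<close>.\<close>
  define L where "L j = (LEAST i. related i j)" for j
  have related_refl: "related j j" for j
    unfolding related_def by (rule exI[of _ 1]) simp
  have related_L: "related (L j) j" and L_le: "L j \<le> j" for j
    unfolding L_def using related_refl by (rule LeastI, rule Least_le)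
  \<comment> \<open>If \<open>y (L j) = 0\<close>, any factor would do. Choosing zero whenever
    \<open>y j = 0\<close> keeps vanishing terms from enlarging the supports of the merged
    coefficients.\<close>
  have coeff: "\<exists>c. y j = sm c (y (L j)) \<and> (y j = 0 \<longrightarrow> c = 0)" for j
    using related_L[of j] unfolding related_def by (cases "y j = 0") auto
  define c where "c j = (SOME c. y j = sm c (y (L j)) \<and> (y j = 0 \<longrightarrow> c = 0))" for j
  have c: "y j = sm (c j) (y (L j))" and c0: "y j = 0 \<Longrightarrow> c j = 0" for j
    using someI_ex[OF coeff[of j]] unfolding c_def[symmetric] by blast+
  \<comment> \<open>The equality case of the triangle inequality makes \<open>y i\<close> and
    \<open>y j\<close> multiples of each other, so they are multiples of the same vectors and have
    the same least index.\<close>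
  have L_eq: "L i = L j" if T: "\<forall>n. T n \<omega> = 0" and nz: "v i \<omega> \<noteq> 0" "v j \<omega> \<noteq> 0" for i j \<omega>
  proof (cases "i = j")
    case False
    have "norm (\<Sum>k<Suc (max i j). v k \<omega>) = (\<Sum>k<Suc (max i j). norm (v k \<omega>))"
      using T[rule_format, of "Suc (max i j)"] unfolding T_def by linarith
    then have "norm (\<Sum>k\<in>{i, j}. v k \<omega>) = (\<Sum>k\<in>{i, j}. norm (v k \<omega>))"
      by (rule norm_sum_eq_subset[rotated 2]) auto
    then have "v i \<omega> /\<^sub>R norm (v i \<omega>) = v j \<omega> /\<^sub>R norm (v j \<omega>)"
      using False nz by (intro strictly_convex_norm_add[OF sc]) auto
    then have e: "sm (of_real (inverse (norm (v i \<omega>))) * f i \<omega>) (y i) =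
        sm (of_real (inverse (norm (v j \<omega>))) * f j \<omega>) (y j)"
      by (simp only: v_def scale_of_real flip: scale_scale)
    define a b where "a = of_real (inverse (norm (v i \<omega>))) * f i \<omega>"
      and "b = of_real (inverse (norm (v j \<omega>))) * f j \<omega>"
    have ab: "sm a (y i) = sm b (y j)" "a \<noteq> 0" "b \<noteq> 0"
      using e nz by (auto simp: a_def b_def v_def)
    have "sm (inverse a * b) (y j) = sm (inverse a * a) (y i)" "sm (inverse b * a) (y i) = sm (inverse b * b) (y j)"
      by (simp_all only: ab(1) flip: scale_scale)
    then have y: "y i = sm (inverse a * b) (y j)" "y j = sm (inverse b * a) (y i)"
      using ab(2,3) by simp_all
    have step: "related k q" if "related k p" "y q = sm d (y p)" for k p q d
    proof -
      from that(1) obtain c where "y p = sm c (y k)" unfolding related_def ..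
      with that(2) have "y q = sm (d * c) (y k)" by simp
      then show ?thesis unfolding related_def ..
    qed
    have "related k i \<longleftrightarrow> related k j" for k
      using step[OF _ y(1)] step[OF _ y(2)] by blast
    then show ?thesis by (simp add: L_def)
  qed simp

  \<comment> \<open>The merged coefficients\<close>
  define h where "h j \<omega> = norm (v j \<omega>)" for j \<omega>
  have h_int: "integrable M (h j)" and int_h: "(\<integral>\<omega>. h j \<omega> \<partial>M) = (\<integral>\<omega>. norm (f j \<omega>) \<partial>M) * norm (y j)"
    and h_nonneg: "0 \<le> h j \<omega>" for j \<omega>
    using int_v[of j] int by (simp_all add: h_def[abs_def] norm_v)
  have h_sum: "summable (\<lambda>j. \<integral>\<omega>. h j \<omega> \<partial>M)"
    unfolding int_h using opt by (rule sums_summable)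
  have h_AE: "AE \<omega> in M. summable (\<lambda>j. h j \<omega>)"
    using AE_summable_norm[of M h] h_int h_sum by (simp add: h_nonneg)
  \<comment> \<open>\<open>G i j\<close> is what term \<open>j\<close> contributes to the
    coefficient merged at \<open>i\<close>; thus \<open>g i\<close> vanishes unless
    \<open>i = L j\<close> for some \<open>j\<close>.\<close>
  define G where "G i j \<omega> = (if L j = i then c j * f j \<omega> else 0)" for i j \<omega>
  define g where "g i \<omega> = (\<Sum>j. G i j \<omega>)" for i \<omega>
  have G_scale: "sm (G i j \<omega>) (y i) = (if L j = i then v j \<omega> else 0)" for i j \<omega>
  proof (cases "L j = i")
    case True
    have "sm (f j \<omega>) (y j) = sm (f j \<omega>) (sm (c j) (y (L j)))"
      using c by (rule arg_cong)
    with True show ?thesis by (simp add: G_def v_def mult.commute)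
  qed (simp add: G_def)
  have G_int: "integrable M (G i j)" for i j
    unfolding G_def[abs_def] using int by (cases "L j = i") simp_all
  \<comment> \<open>If \<open>y i = 0\<close>, the right side is zero by
    \<open>inverse 0 = 0\<close>. The left side is then zero too, since \<open>L j = i\<close>
    implies \<open>y j = 0\<close> and so \<open>c j = 0\<close>.\<close>
  have G_le: "norm (G i j \<omega>) \<le> h j \<omega> * inverse (norm (y i))" for i j \<omega>
  proof (cases "L j = i \<and> y j \<noteq> 0")
    case True
    then have "y i \<noteq> 0" using c[of j] by auto
    moreover have "norm (G i j \<omega>) * norm (y i) = h j \<omega>"
      using True G_scale[of i j \<omega>] by (simp add: h_def flip: norm_scale)
    ultimately show ?thesis by (simp add: field_simps)
  next
    case False
    then show ?thesis using h_nonneg by (auto simp: G_def c0)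
  qed
  have G_AE: "AE \<omega> in M. summable (\<lambda>j. norm (G i j \<omega>))" for i
    using h_AE
  proof eventually_elim
    case (elim \<omega>)
    from summable_mult2[OF elim, of "inverse (norm (y i))"] show ?case
      by (rule summable_comparison_test'[where N = 0]) (simp add: G_le)
  qed
  have g_int: "integrable M (g i)" for i
    unfolding g_def[abs_def]
  proof (rule integrable_suminf[OF G_int G_AE])
    have "(\<integral>\<omega>. norm (G i j \<omega>) \<partial>M) \<le> (\<integral>\<omega>. h j \<omega> \<partial>M) * inverse (norm (y i))" for j
      using integral_mono[of M "\<lambda>\<omega>. norm (G i j \<omega>)" "\<lambda>\<omega>. h j \<omega> * inverse (norm (y i))"] G_int h_int G_le
      by simp
    then show "summable (\<lambda>j. \<integral>\<omega>. norm (G i j \<omega>) \<partial>M)"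
      by (intro summable_comparison_test'[OF summable_mult2[OF h_sum, of "inverse (norm (y i))"], where N = 0]) simp
  qed

  \<comment> \<open>Convergence of the merged series to the same element\<close>
  define R where "R n \<omega> = (\<Sum>j. if j < n then 0 else h j \<omega>)" for n \<omega>
  have tail: "(\<lambda>j. if j < n then 0 else a j) sums (suminf a - (\<Sum>j<n. a j))"
    if "summable a" for n and a :: "nat \<Rightarrow> real"
  proof -
    have "(\<lambda>j. a j - (if j \<in> {..<n} then a j else 0)) sums (suminf a - (\<Sum>j<n. a j))"
      using that by (intro sums_diff summable_sums sums_If_finite_set) auto
    then show ?thesis by (rule back_subst[where P = "\<lambda>q. q sums _"]) auto
  qed
  have R_int: "integrable M (R n)" and R_lim: "(\<integral>\<omega>. R n \<omega> \<partial>M) =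
      (\<Sum>j. \<integral>\<omega>. h j \<omega> \<partial>M) - (\<Sum>j<n. \<integral>\<omega>. h j \<omega> \<partial>M)" for n
  proof -
    let ?h = "\<lambda>j \<omega>. if j < n then 0 else h j \<omega>"
    have eq: "(\<integral>\<omega>. ?h j \<omega> \<partial>M) = (if j < n then 0 else \<integral>\<omega>. h j \<omega> \<partial>M)"
      "norm (?h j \<omega>) = ?h j \<omega>" for j \<omega>
      using h_nonneg by auto
    have "integrable M (?h j)" for j using h_int by (cases "j < n") simp_all
    moreover have "AE \<omega> in M. summable (\<lambda>j. norm (?h j \<omega>))"
      using h_AE by eventually_elim (use tail sums_summable in \<open>unfold eq, blast\<close>)
    moreover have "summable (\<lambda>j. \<integral>\<omega>. norm (?h j \<omega>) \<partial>M)"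
      unfolding eq using tail[OF h_sum] by (rule sums_summable)
    ultimately have "integrable M (\<lambda>\<omega>. \<Sum>j. ?h j \<omega>)" "(\<integral>\<omega>. (\<Sum>j. ?h j \<omega>) \<partial>M) = (\<Sum>j. \<integral>\<omega>. ?h j \<omega> \<partial>M)"
      by (rule integrable_suminf, rule integral_suminf)
    then show "integrable M (R n)" "(\<integral>\<omega>. R n \<omega> \<partial>M) =
        (\<Sum>j. \<integral>\<omega>. h j \<omega> \<partial>M) - (\<Sum>j<n. \<integral>\<omega>. h j \<omega> \<partial>M)"
      using tail[OF h_sum, of n] by (simp_all add: R_def[abs_def] eq sums_iff)
  qed

  \<comment> \<open>The merged partial sum adds up the \<open>v j\<close> with
    \<open>L j < n\<close>. As \<open>L j \<le> j\<close>, these include all \<open>j < n\<close>,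
    so the difference consists of terms with \<open>j \<ge> n\<close> and is bounded by the tail
    \<open>R n\<close>.\<close>
  have close: "pn (part f y n - part g y n) \<le> (\<integral>\<omega>. R n \<omega> \<partial>M)" for n
  proof -
    let ?D = "\<lambda>\<omega>. (\<Sum>i<n. sm (f i \<omega>) (y i)) - (\<Sum>i<n. sm (g i \<omega>) (y i))"
    have dec: "decomp (part f y n - part g y n) ?D
      ((\<Sum>i<n. (\<integral>\<omega>. norm (f i \<omega>) \<partial>M) * norm (y i)) + (\<Sum>i<n. (\<integral>\<omega>. norm (g i \<omega>) \<partial>M) * norm (y i)))"
      by (rule decomp_diff[OF decomp_part[OF int] decomp_part[OF g_int]])
    have "AE \<omega> in M. \<forall>i. summable (\<lambda>j. norm (G i j \<omega>))"
      using G_AE by (simp add: AE_all_countable)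
    with h_AE have "AE \<omega> in M. norm (?D \<omega>) \<le> R n \<omega>"
    proof eventually_elim
      case (elim \<omega>)
      have "(\<lambda>j. sm (G i j \<omega>) (y i)) sums sm (g i \<omega>) (y i)" for i
        unfolding g_def using elim by (intro sums_scale_left summable_sums) (auto intro: summable_norm_cancel)
      then have "(\<lambda>j. \<Sum>i<n. sm (G i j \<omega>) (y i)) sums (\<Sum>i<n. sm (g i \<omega>) (y i))"
        by (intro sums_sum) auto
      moreover have "(\<Sum>i<n. sm (G i j \<omega>) (y i)) = (if L j < n then v j \<omega> else 0)" for j
        by (simp add: G_scale)
      moreover have "(\<lambda>j. if j \<in> {..<n} then v j \<omega> else 0) sums (\<Sum>j<n. v j \<omega>)"
        by (rule sums_If_finite_set) simp
      ultimately have D: "(\<lambda>j. (if j \<in> {..<n} then v j \<omega> else 0) - (if L j < n then v j \<omega> else 0)) sums ?D \<omega>"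
        by (auto simp: v_def intro: sums_diff)
      have "norm ((if j \<in> {..<n} then v j \<omega> else 0) - (if L j < n then v j \<omega> else 0)) \<le>
          (if j < n then 0 else h j \<omega>)" for j
        using L_le[of j] h_nonneg by (auto simp: h_def)
      with sums_summable[OF tail[OF elim(1)]]
      have "norm (\<Sum>j. (if j \<in> {..<n} then v j \<omega> else 0) - (if L j < n then v j \<omega> else 0)) \<le> R n \<omega>"
        unfolding R_def by (intro norm_suminf_le)
      with D show ?case by (simp add: sums_iff)
    qed
    then show ?thesis
      unfolding alg_proj_norm_eq[OF dec]
      using decomp_integrable(1)[OF dec] R_int by (intro integral_mono_AE)
  qed
  have "(\<lambda>n. \<integral>\<omega>. R n \<omega> \<partial>M) \<longlonglongrightarrow> (\<Sum>j. \<integral>\<omega>. h j \<omega> \<partial>M) - (\<Sum>j. \<integral>\<omega>. h j \<omega> \<partial>M)"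
    unfolding R_lim using summable_LIMSEQ[OF h_sum] by (intro tendsto_diff tendsto_const)
  then have "(\<lambda>n. pn (part f y n - part g y n)) \<longlonglongrightarrow> 0"
    using close int g_int
    by (intro pn_squeeze[where b = "\<lambda>n. \<integral>\<omega>. R n \<omega> \<partial>M"] alg_tensor_diff part_in_alg_tensor) auto
  with part_in_alg_tensor[of g, OF g_int] have g_mem: "part g y \<in> u"
    by (rule proj_tensor_memI[OF u mem])

  \<comment> \<open>Disjointness of the merged supports\<close>
  have "AE \<omega> in M. g i \<omega> = 0 \<or> g j \<omega> = 0" if "i \<noteq> j" for i j
    using T_AE
  proof eventually_elim
    case (elim \<omega>)
    have nz: "\<exists>k. L k = i \<and> v k \<omega> \<noteq> 0" if "g i \<omega> \<noteq> 0" for i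
    proof -
      have "\<exists>k. G i k \<omega> \<noteq> 0"
        using that by (rule contrapos_np) (simp add: g_def)
      then obtain k where k: "G i k \<omega> \<noteq> 0" ..
      then have "y k \<noteq> 0" "L k = i" "f k \<omega> \<noteq> 0" using c0 by (auto simp: G_def split: if_splits)
      then show ?thesis by (auto simp: v_def)
    qed
    show ?case
      using nz[of i] nz[of j] L_eq[OF elim] \<open>i \<noteq> j\<close> by metis
  qed
  then have "emeasure M (supp M (g i) \<inter> supp M (g j)) = 0" if "i \<noteq> j" for i j
    using that supp_inter_null_iff[OF g_int g_int] by blast
  with u g_int g_mem show "u \<in> disjoint_tensors M Y"
    unfolding disjoint_tensors_def tensor_sums_def by auto
qed

text \<open>The segment joining two unit vectors whose midpoint is a unit vector lies in the unit sphere.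
  Two of its points on one line through the origin would differ by a unimodular factor, which has to
  be one because their midpoint has norm one as well.\<close>

lemma flat_segment_line_unique:
  fixes a b z :: 'y
  assumes unit: "norm a = 1" "norm b = 1" "2 \<le> norm (a + b)" "a \<noteq> b"
    and t: "0 \<le> t" "t \<le> 1" "0 \<le> t'" "t' \<le> 1"
    and line: "t *\<^sub>R a + (1 - t) *\<^sub>R b = sm c z" "t' *\<^sub>R a + (1 - t') *\<^sub>R b = sm c' z"
  shows "t = t'"
proof -
  note one = norm_convex_combination_eq_one[OF unit(1-3)]
  let ?m = "(t + t') / 2"
  have n: "norm (sm c z) = 1" "norm (sm c' z) = 1"
    using one[of t] one[of t'] t line by simp_all
  then have nc: "c \<noteq> 0" "norm c * norm z = 1" "norm c' * norm z = 1"
    by (auto simp: norm_scale)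
  define d where "d = c' / c"
  have "norm c' = norm c"
    using nc by (metis mult_cancel_right mult_zero_right zero_neq_one)
  then have nd: "norm d = 1" using nc(1) by (simp add: d_def norm_divide)
  have c': "sm c' z = sm d (sm c z)" using nc(1) by (simp add: d_def)
  have "sm (1 + d) (sm c z) = sm c z + sm c' z"
    by (simp only: c' scale_left_distrib scale_one)
  also have "\<dots> = 2 *\<^sub>R (?m *\<^sub>R a + (1 - ?m) *\<^sub>R b)"
    unfolding line[symmetric] by (simp add: algebra_simps add_divide_distrib scaleR_2)
  finally have "norm (1 + d) * norm (sm c z) = 2 * norm (?m *\<^sub>R a + (1 - ?m) *\<^sub>R b)"
    by (simp only: norm_scale[symmetric] norm_scaleR abs_numeral)
  moreover have "norm (?m *\<^sub>R a + (1 - ?m) *\<^sub>R b) = 1"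
    by (rule one) (use t in auto)
  ultimately have "norm (1 + d) = 2"
    unfolding n(1) by linarith
  with nd have "d = 1" by (rule real_or_complex_eq_one)
  then have "t *\<^sub>R a + (1 - t) *\<^sub>R b = t' *\<^sub>R a + (1 - t') *\<^sub>R b"
    using c' by (simp only: line scale_one)
  then have "(t - t') *\<^sub>R (a - b) = 0"
    by (simp add: algebra_simps)
  with unit(4) show ?thesis by simp
qed

lemma NA_not_subset_disjoint:
  assumes npa: "\<not> purely_atomic M" and nsc: "\<not> strictly_convex Y"
  shows "\<not> NA_proj X Y \<subseteq> disjoint_tensors M Y"
proof -
  obtain a b :: 'y where unit: "norm a = 1" "norm b = 1" "2 \<le> norm (a + b)" "a \<noteq> b"
    using nsc unfolding strictly_convex_iff not_less[symmetric] by blast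
  obtain F where F: "F \<in> fmeasurable M" "0 < emeasure M F" "\<And>A. A \<subseteq> F \<Longrightarrow> \<not> atom M A"
    using not_purely_atomicE[OF npa] by blast
  obtain \<tau> :: "'a \<Rightarrow> real" where \<tau>: "\<tau> \<in> borel_measurable M" "\<And>\<omega>. 0 \<le> \<tau> \<omega>" "\<And>\<omega>. \<tau> \<omega> \<le> 1"
    and diffuse: "\<And>t. {\<omega> \<in> F. \<tau> \<omega> = t} \<in> null_sets M"
    using atomless_diffuse_function[OF F(1,3)] by blast
  have F_sets: "F \<in> sets M" and F_int: "integrable M (indicat_real F)"
    using F(1) by (auto simp: fmeasurable_def)
  \<comment> \<open>Over \<open>F\<close> the function \<open>w\<close> defined below runs through
    the segment between \<open>a\<close> and \<open>b\<close>, with \<tau> as parameter; outside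
    \<open>F\<close> it vanishes.\<close>
  define p where "p \<omega> = indicat_real F \<omega> * \<tau> \<omega>" for \<omega>
  define q where "q \<omega> = indicat_real F \<omega> * (1 - \<tau> \<omega>)" for \<omega>
  have pq_int: "integrable M p" "integrable M q"
    unfolding p_def[abs_def] q_def[abs_def] using \<tau> F_sets
    by (auto intro!: Bochner_Integration.integrable_bound[OF F_int] split: split_indicator)
  have pq_nonneg: "0 \<le> p \<omega>" "0 \<le> q \<omega>" for \<omega>
    using \<tau>(2,3) by (simp_all add: p_def q_def)
  \<comment> \<open>The sum of two elementary tensors as a series with zero terms from index
    \<open>2\<close> on; its partial sums are constant from \<open>n = 2\<close>.\<close>
  define f :: "nat \<Rightarrow> 'a \<Rightarrow> 'k" where
    "f i = (if i = 0 then (\<lambda>\<omega>. of_real (p \<omega>)) else if i = 1 then (\<lambda>\<omega>. of_real (q \<omega>)) else (\<lambda>_. 0))" for i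
  define y where "y i = (if i = 0 then a else if i = 1 then b else 0)" for i :: nat
  have f_int: "integrable M (f i)" for i
    using pq_int by (auto simp: f_def)
  define w where "w \<omega> = p \<omega> *\<^sub>R a + q \<omega> *\<^sub>R b" for \<omega>
  have sum2: "(\<Sum>i<n. P i) = P 0 + P 1" if "n \<ge> 2" "\<And>i. i \<ge> 2 \<Longrightarrow> P i = 0"
    for n and P :: "nat \<Rightarrow> 'z::comm_monoid_add"
  proof -
    have "(\<Sum>i<n. P i) = (\<Sum>i<2. P i)"
      using that by (intro sum.mono_neutral_right) auto
    then show ?thesis by (simp add: numeral_2_eq_2)
  qed
  have w_sum: "(\<Sum>i<n. sm (f i \<omega>) (y i)) = w \<omega>" if "n \<ge> 2" for n \<omega>
    by (subst sum2[OF that]) (auto simp: f_def y_def w_def scale_of_real)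
  have norm_w: "norm (w \<omega>) = indicator F \<omega>" for \<omega>
    using norm_convex_combination_eq_one[OF unit(1-3) \<tau>(2,3)]
    by (auto simp: w_def p_def q_def split: split_indicator)
  have part_const: "part f y n = part f y 2" if "n \<ge> 2" for n
    using that by (subst (1 2) sum2) (auto simp: f_def)
  have "\<exists>N. \<forall>m\<ge>N. \<forall>n\<ge>N. pn (part f y m - part f y n) < e" if "e > 0" for e
  proof (intro exI[of _ 2] allI impI)
    fix m n :: nat assume mn: "m \<ge> 2" "n \<ge> 2"
    have "pn (part f y m - part f y n) = 0"
      unfolding part_const[OF mn(1)] part_const[OF mn(2)] by (simp only: diff_self pn_zero)
    with that show "pn (part f y m - part f y n) < e" by (simp only:)
  qed
  then have "part f y \<in> tensor_Cauchy X Y"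
    unfolding tensor_Cauchy_def using part_in_alg_tensor[of f, OF f_int] by blast
  then obtain u where u: "u \<in> proj_tensor X Y" "part f y \<in> u"
    using proj_tensor_classI by blast
  have pn_part: "pn (part f y n) = (\<integral>\<omega>. indicator F \<omega> \<partial>M)" if "n \<ge> 2" for n
    using alg_proj_norm_eq[OF decomp_part[of f y, OF f_int]] by (simp add: w_sum[OF that] norm_w)
  have "u \<in> NA_proj X Y"
  proof -
    have cost: "pn (part f y n) = (\<Sum>i<n. (\<integral>\<omega>. norm (f i \<omega>) \<partial>M) * norm (y i))" if "n \<ge> 2" for n
    proof -
      have "(\<Sum>i<n. (\<integral>\<omega>. norm (f i \<omega>) \<partial>M) * norm (y i)) = (\<integral>\<omega>. p \<omega> \<partial>M) + (\<integral>\<omega>. q \<omega> \<partial>M)"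
        using pq_nonneg by (subst sum2[OF that]) (auto simp: f_def y_def unit)
      also have "\<dots> = (\<integral>\<omega>. p \<omega> + q \<omega> \<partial>M)"
        using pq_int by simp
      also have "\<dots> = (\<integral>\<omega>. indicator F \<omega> \<partial>M)"
        by (simp add: p_def q_def algebra_simps)
      finally show ?thesis using pn_part[OF that] by simp
    qed
    have "(\<lambda>n. \<Sum>i<n. (\<integral>\<omega>. norm (f i \<omega>) \<partial>M) * norm (y i)) \<longlonglongrightarrow> proj_norm X Y u"
      by (rule Lim_transform_eventually[OF proj_norm_tendsto[OF u] eventually_sequentiallyI[of 2, OF cost]])
    then show ?thesis
      using u f_int unfolding NA_proj_def tensor_sums_def by (auto simp: sums_def)
  qed
  moreover have "u \<notin> disjoint_tensors M Y"
  proof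
    assume "u \<in> disjoint_tensors M Y"
    then obtain g z where g: "\<And>i. integrable M (g i)" "part g z \<in> u"
      and disj: "AE \<omega> in M. \<forall>i j. i \<noteq> j \<longrightarrow> g i \<omega> = 0 \<or> g j \<omega> = 0"
      by (rule disjoint_tensorsE) blast
    define S where "S n \<omega> = (\<Sum>i<n. sm (g i \<omega>) (z i))" for n \<omega>
    define D where "D n \<omega> = norm ((\<Sum>i<n. sm (f i \<omega>) (y i)) - S n \<omega>)" for n \<omega>
    note dec = decomp_diff[OF decomp_part[of f y, OF f_int] decomp_part[of g z, OF g(1)]]
    have D_int: "integrable M (D n)" for n
      unfolding D_def[abs_def] S_def by (rule decomp_integrable(1)[OF dec])
    have D_lim: "(\<lambda>n. \<integral>\<omega>. norm (D n \<omega>) \<partial>M) \<longlonglongrightarrow> 0"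
      using proj_tensor_equivD(2)[OF u g(2)] by (simp add: alg_proj_norm_eq[OF dec] D_def S_def)
    \<comment> \<open>Both series represent \<open>u\<close>, so their partial sums approach each
      other in \<open>L\<^sub>1\<close>, and along a subsequence almost everywhere.\<close>
    from tendsto_L1_AE_subseq[of M D, OF D_int D_lim] obtain r where r: "strict_mono r" and lim: "AE \<omega> in M. (\<lambda>n. D (r n) \<omega>) \<longlonglongrightarrow> 0"
      by blast
    have "AE \<omega> in M. \<omega> \<in> F \<longrightarrow> (\<exists>i c. w \<omega> = sm c (z i))"
      using disj lim
    proof eventually_elim
      case (elim \<omega>)
      \<comment> \<open>At most one term is nonzero at \<omega>, so the partial sums are eventually
        constant with value on the line through some \<open>z i\<close>. If no term is nonzero, the
        value is zero times \<open>z 0\<close>.\<close>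
      have "\<exists>i c N. \<forall>n\<ge>N. S n \<omega> = sm c (z i)"
      proof (cases "\<exists>i. g i \<omega> \<noteq> 0")
        case True
        then obtain i where i: "g i \<omega> \<noteq> 0" ..
        have "S n \<omega> = sm (g i \<omega>) (z i)" if "n \<ge> Suc i" for n
        proof -
          have "S n \<omega> = (\<Sum>j\<in>{i}. sm (g j \<omega>) (z j))"
            unfolding S_def using that elim(1) i by (intro sum.mono_neutral_right) auto
          then show ?thesis by simp
        qed
        then show ?thesis by blast
      next
        case False
        then have "\<forall>n\<ge>0. S n \<omega> = sm 0 (z 0)" by (simp add: S_def)
        then show ?thesis by blast
      qed
      then obtain i c N where N: "\<And>n. n \<ge> N \<Longrightarrow> S n \<omega> = sm c (z i)" by blast
      have "\<forall>\<^sub>F n in sequentially. D (r n) \<omega> = norm (w \<omega> - sm c (z i))"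
        using eventually_ge_at_top[of "max N 2"]
      proof eventually_elim
        case (elim n)
        then have "r n \<ge> N" "r n \<ge> 2" using seq_suble[OF r, of n] by auto
        then show ?case by (simp add: D_def w_sum N)
      qed
      from Lim_transform_eventually[OF elim(2) this] have "norm (w \<omega> - sm c (z i)) = 0"
        by (simp add: tendsto_const_iff)
      then show ?case by auto
    qed
    \<comment> \<open>The line through \<open>z i\<close> meets the segment in at most one point, so
      within \<open>F\<close> the values of \<open>w\<close> lie on it only over a single level set
      of \<tau>, which is null.\<close>
    moreover have "AE \<omega> in M. \<omega> \<in> F \<longrightarrow> (\<nexists>c. w \<omega> = sm c (z i))" for i
    proof (cases "\<exists>\<omega>\<in>F. \<exists>c. w \<omega> = sm c (z i)")
      case True
      then obtain \<omega>' c' where w': "\<omega>' \<in> F" "w \<omega>' = sm c' (z i)" by blast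
      have "\<tau> \<omega> = \<tau> \<omega>'" if "\<omega> \<in> F" "w \<omega> = sm c (z i)" for \<omega> c
        using that w'
        by (intro flat_segment_line_unique[OF unit \<tau>(2,3) \<tau>(2,3), where z = "z i" and c = c and c' = c'])
          (simp_all add: w_def p_def q_def)
      then show ?thesis
        by (intro AE_I'[OF diffuse[of "\<tau> \<omega>'"]]) auto
    qed auto
    then have "AE \<omega> in M. \<forall>i. \<omega> \<in> F \<longrightarrow> (\<nexists>c. w \<omega> = sm c (z i))"
      by (simp only: AE_all_countable simp_thms)
    ultimately have "AE \<omega> in M. \<omega> \<notin> F"
      by eventually_elim blast
    then show False
      using F(2) AE_iff_null_sets[OF F_sets] by (auto simp: null_sets_def)
  qed
  ultimately show ?thesis by blast
qed

end

theorem proposition3p13: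
  fixes M :: "'a measure"
    and sm :: "'k::real_or_complex \<Rightarrow> 'y::banach \<Rightarrow> 'y"
  assumes "\<not> purely_atomic M"
    and "banach_scale sm"
    and "\<exists>S. card S = 2 \<and> \<not> module.dependent sm S"
  shows "(NA_proj (L1 M) (whole_space sm) = disjoint_tensors M (whole_space sm)
            \<longleftrightarrow> strictly_convex (whole_space sm)) \<and>
         (\<not> strictly_convex (whole_space sm) \<longrightarrow>
            disjoint_tensors M (whole_space sm) \<subset> NA_proj (L1 M) (whole_space sm))"
proof -
  interpret L1_tensor sm M
    using assms(2) by unfold_locales
  show ?thesis
    using disjoint_subset_NA NA_subset_disjoint NA_not_subset_disjoint[OF assms(1)] by blast
qed

end
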